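(* Let $n\ge1$, let $\lambda\vdash n$, and let $F_\lambda(q)$ be the number of $n\times n$ upper-triangular nilpotent matrices over $\mathbb{F}_q$ of Jordan type $\lambda$. Let $\mathcal{S}(\lambda)$ denote the set of all set partitions of $[n]$ of partition type $\lambda$. Then $$F_\lambda(q)=\sum_{S\in\mathcal{S}(\lambda)}F_S(q).$$
   Context: Upper-triangular nilpotent matrices are the strictly upper-triangular ones; $q$ is a prime power. A nilpotent $n\times n$ matrix $X$ over $\mathbb{F}_q$ has Jordan type $\lambda=(\lambda_1\ge\cdots\ge\lambda_r>0)\vdash n$ if it is similar to $J_{\lambda_1}\oplus\cdots\oplus J_{\lambda_r}$, where $J_i$ is the $i\times i$ Jordan block with eigenvalue $0$. Set partitions of $[n]=\{1,\ldots,n\}$: blocks of a set partition $S=(s_1,\ldots,s_m)$ are always listed so that $|s_1|\ge|s_2|\ge\cdots\ge|s_m|$, and $\min s_i<\min s_{i+1}$ if $|s_i|=|s_{i+1}|$. $\ell(S)$ is the number of blocks. The partition type of $S$ is $(|s_1|,\ldots,|s_m|)$. For $1\le i\le n$, $S^{(i)}$ is the set partition of $[i]$ obtained by restricting $S$ to $[i]$ (discarding empty blocks), with blocks reordered by the same convention (weakly decreasing size, blocks of equal size in increasing order of their minima); $\ell(S^{(0)})=0$. If $i$ is the least element of its block, set $S^{(i)}(q)=q^{\,i-1-\ell(S^{(i-1)})}$. Otherwise let $u$ be the least element of the block of $S^{(i)}$ containing $i$, let $r$ be the index of the block of $S^{(i-1)}$ containing $u$, where the blocks of $S^{(i-1)}$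 are indexed $1,2,\ldots,\ell(S^{(i-1)})$ in order of weakly decreasing size, with blocks of equal size in increasing order of their minima, and set $S^{(i)}(q)=(q-1)q^{\,i-1-r}$. The weight of $S$ is $F_S(q)=\prod_{i=1}^nS^{(i)}(q)$. *)

theory Defs
  imports "Jordan_Normal_Form.Jordan_Normal_Form" "HOL-Library.Disjoint_Sets" "HOL-Library.Cardinality"
begin

definition is_partition :: "nat \<Rightarrow> nat list \<Rightarrow> bool" where
  "is_partition n lam \<longleftrightarrow> sorted_wrt (\<ge>) lam \<and> (\<forall>k\<in>set lam. 0 < k) \<and> sum_list lam = n"

definition nilpotent_mat :: "'a::semiring_1 mat \<Rightarrow> bool" where
  "nilpotent_mat X \<longleftrightarrow> (\<exists>k. X ^\<^sub>m k = 0\<^sub>m (dim_row X) (dim_row X))"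

definition has_jordan_type :: "'a::semiring_1 mat \<Rightarrow> nat list \<Rightarrow> bool" where
  "has_jordan_type X lam \<longleftrightarrow> jordan_nf X (map (\<lambda>k. (k, 0)) lam)"

definition upper_nilpotents_of_type :: "nat \<Rightarrow> nat list \<Rightarrow> 'a::semiring_1 mat set" where
  "upper_nilpotents_of_type n lam =
    {X \<in> carrier_mat n n. upper_triangular X \<and> nilpotent_mat X \<and> has_jordan_type X lam}"

definition block_before :: "nat set \<Rightarrow> nat set \<Rightarrow> bool" where
  "block_before s t \<longleftrightarrow> card t < card s \<or> card s = card t \<and> Min s < Min t"

text \<open>The standard listing of the blocks; it is well defined for every partition of a finite set
  of numbers, see \<open>blocks_unique\<close> below.\<close>

definition blocks :: "nat set set \<Rightarrow> nat set list" where
  "blocks S = (THE bs. set bs = S \<and> sorted_wrt block_before bs)"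

definition partition_type :: "nat set set \<Rightarrow> nat list" where
  "partition_type S = map card (blocks S)"

definition set_partitions_of_type :: "nat \<Rightarrow> nat list \<Rightarrow> nat set set set" where
  "set_partitions_of_type n lam = {S. partition_on {1..n} S \<and> partition_type S = lam}"

definition restrict_partition :: "nat set set \<Rightarrow> nat \<Rightarrow> nat set set" where
  "restrict_partition S i = (\<lambda>s. s \<inter> {1..i}) ` S - {{}}"

definition block_of :: "nat set set \<Rightarrow> nat \<Rightarrow> nat set" where
  "block_of S x = (THE s. s \<in> S \<and> x \<in> s)"

text \<open>Blocks are indexed from 1, whereas list positions start at 0.\<close>

definition block_index :: "nat set set \<Rightarrow> nat \<Rightarrow> nat" where
  "block_index S x = (THE r. 1 \<le> r \<and> r \<le> length (blocks S) \<and> x \<in> blocks S ! (r - 1))"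

text \<open>The truncated subtractions in the exponents are exact: for \<open>1 \<le> i \<le> n\<close> the partition
  \<open>restrict_partition S (i - 1)\<close> of \<open>{1..i - 1}\<close> has at most \<open>i - 1\<close> blocks, which bounds
  both the number of blocks and the index of any block.\<close>

definition step_weight :: "nat set set \<Rightarrow> int \<Rightarrow> nat \<Rightarrow> int" where
  "step_weight S q i =
    (if i = Min (block_of S i)
     then q ^ (i - 1 - length (blocks (restrict_partition S (i - 1))))
     else let u = Min (block_of (restrict_partition S i) i);
              r = block_index (restrict_partition S (i - 1)) u
          in (q - 1) * q ^ (i - 1 - r))"

definition weight :: "nat \<Rightarrow> nat set set \<Rightarrow> int \<Rightarrow> int" where
  "weight n S q = (\<Prod>i\<in>{1..n}. step_weight S q i)"

lemma blocks_unique: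
  assumes "finite A" and "partition_on A S"
  shows "\<exists>!bs. set bs = S \<and> sorted_wrt block_before bs"
proof -
  have fS: "finite S" using assms finite_elements by blast
  have fin: "finite s" if "s \<in> S" for s
    using assms that by (auto simp: partition_on_def intro: finite_subset)
  have irr: "\<not> block_before s s" for s by (simp add: block_before_def)
  have tr: "block_before s t \<Longrightarrow> block_before t u \<Longrightarrow> block_before s u" for s t u
    by (auto simp: block_before_def)
  have tot: "block_before s t \<or> block_before t s" if "s \<in> S" "t \<in> S" "s \<noteq> t" for s t
  proof -
    have ne: "s \<noteq> {}" "t \<noteq> {}" using assms(2) that by (auto simp: partition_on_def)
    have "s \<inter> t = {}"
      using assms(2) that by (auto simp: partition_on_def disjoint_def)
    hence "Min s \<noteq> Min t" using Min_in fin that ne by (metis disjoint_iff)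
    thus ?thesis unfolding block_before_def by linarith
  qed
  have ex: "\<exists>bs. set bs = T \<and> sorted_wrt block_before bs" if "finite T" "T \<subseteq> S" for T
    using that
  proof (induction "card T" arbitrary: T)
    case 0
    then show ?case by (intro exI[of _ "[]"]) auto
  next
    case (Suc k)
    have ne: "T \<noteq> {}" using Suc.hyps(2) by auto
    have "\<exists>m\<in>T. \<forall>s\<in>T. s \<noteq> m \<longrightarrow> block_before m s"
      using Suc.prems(1) ne Suc.prems(2)
    proof (induction T rule: finite_ne_induct)
      case (singleton x)
      then show ?case by simp
    next
      case (insert x F)
      then obtain m where "m \<in> F" "\<forall>s\<in>F. s \<noteq> m \<longrightarrow> block_before m s" by auto
      moreover have "block_before m x \<or> block_before x m"
        using tot[of m x] insert calculation by auto
      ultimately show ?case using tr by (metis insert_iff)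
    qed
    then obtain m where m: "m \<in> T" "\<forall>s\<in>T. s \<noteq> m \<longrightarrow> block_before m s" by blast
    have "k = card (T - {m})" using Suc m by simp
    then obtain bs where "set bs = T - {m}" "sorted_wrt block_before bs"
      using Suc.hyps(1)[of "T - {m}"] Suc.prems by auto
    then show ?case using m by (intro exI[of _ "m # bs"]) auto
  qed
  have uni: "xs = ys"
    if "set xs = set ys" "sorted_wrt block_before xs" "sorted_wrt block_before ys" for xs ys
    using that
  proof (induction xs arbitrary: ys)
    case Nil
    then show ?case by simp
  next
    case (Cons x xs)
    then obtain y ys' where ys: "ys = y # ys'" by (cases ys) auto
    have xy: "x = y"
    proof (rule ccontr)
      assume "x \<noteq> y"
      then have "x \<in> set ys'" "y \<in> set xs" using Cons.prems(1) ys by auto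
      then have "block_before y x" "block_before x y" using Cons.prems ys by auto
      then show False using tr irr by blast
    qed
    have "x \<notin> set xs" "y \<notin> set ys'" using Cons.prems ys irr by auto
    then have "set xs = set ys'" using Cons.prems(1) ys xy by auto
    then show ?case using Cons ys xy by simp
  qed
  show ?thesis using ex[OF fS] uni by blast
qed

text \<open>The upper-triangular nilpotent matrices over a field are the strictly upper-triangular ones.\<close>

lemma upper_triangular_nilpotent_iff:
  fixes X :: "'a::field mat"
  assumes X: "X \<in> carrier_mat n n"
  shows "upper_triangular X \<and> nilpotent_mat X \<longleftrightarrow> (\<forall>i<n. \<forall>j\<le>i. X $$ (i, j) = 0)"
proof
  assume asm: "upper_triangular X \<and> nilpotent_mat X"
  have ut: "X $$ (i, j) = 0" if "j < i" "i < n" for i j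
    using asm X that by (auto simp: upper_triangular_def)
  have P: "X ^\<^sub>m k \<in> carrier_mat n n" for k using X by simp
  have pw: "(\<forall>i<n. \<forall>j<i. (X ^\<^sub>m k) $$ (i, j) = 0) \<and>
    (\<forall>i<n. (X ^\<^sub>m k) $$ (i, i) = (X $$ (i, i)) ^ k)" for k
  proof (induction k)
    case 0
    then show ?case using X by auto
  next
    case (Suc k)
    have e: "(X ^\<^sub>m Suc k) $$ (i, j) = (\<Sum>l\<in>{0..<n}. (X ^\<^sub>m k) $$ (i, l) * X $$ (l, j))"
      if "i < n" "j < n" for i j
      using that X P[of k] by (auto simp: scalar_prod_def)
    have "(X ^\<^sub>m Suc k) $$ (i, j) = 0" if "i < n" "j < i" for i j
    proof -
      have "(X ^\<^sub>m k) $$ (i, l) * X $$ (l, j) = 0" if "l < n" for l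
        using that \<open>i < n\<close> \<open>j < i\<close> Suc ut by (cases "l < i") auto
      then have "(\<Sum>l\<in>{0..<n}. (X ^\<^sub>m k) $$ (i, l) * X $$ (l, j)) = 0"
        by (intro sum.neutral) auto
      then show ?thesis using e[of i j] that by simp
    qed
    moreover have "(X ^\<^sub>m Suc k) $$ (i, i) = X $$ (i, i) ^ Suc k" if "i < n" for i
    proof -
      have "(X ^\<^sub>m k) $$ (i, l) * X $$ (l, i) = (if l = i then X $$ (i, i) ^ Suc k else 0)"
        if "l < n" for l
        using that \<open>i < n\<close> Suc ut by (cases l i rule: linorder_cases) auto
      then show ?thesis using e[OF that that] that by (simp add: sum.delta)
    qed
    ultimately show ?case by blast
  qed
  obtain k where k: "X ^\<^sub>m k = 0\<^sub>m n n" using asm X by (auto simp: nilpotent_mat_def)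
  have "X $$ (i, i) = 0" if "i < n" for i
    using pw[of k] k that by (metis index_zero_mat(1) power_eq_0_iff)
  then show "\<forall>i<n. \<forall>j\<le>i. X $$ (i, j) = 0" using ut by (metis le_neq_implies_less)
next
  assume z: "\<forall>i<n. \<forall>j\<le>i. X $$ (i, j) = 0"
  have P: "X ^\<^sub>m k \<in> carrier_mat n n" for k using X by simp
  have "\<forall>i<n. \<forall>j<n. j < i + k \<longrightarrow> (X ^\<^sub>m k) $$ (i, j) = 0" for k
  proof (induction k)
    case 0
    then show ?case using X by auto
  next
    case (Suc k)
    show ?case
    proof (intro allI impI)
      fix i j assume ij: "i < n" "j < n" "j < i + Suc k"
      have "(X ^\<^sub>m Suc k) $$ (i, j) = (\<Sum>l\<in>{0..<n}. (X ^\<^sub>m k) $$ (i, l) * X $$ (l, j))"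
        using ij X P[of k] by (auto simp: scalar_prod_def)
      also have "\<dots> = 0"
      proof (rule sum.neutral, rule ballI)
        fix l assume "l \<in> {0..<n}"
        then show "(X ^\<^sub>m k) $$ (i, l) * X $$ (l, j) = 0"
          using Suc z ij by (cases "l < i + k") auto
      qed
      finally show "(X ^\<^sub>m Suc k) $$ (i, j) = 0" .
    qed
  qed
  from this[of n] have "X ^\<^sub>m n = 0\<^sub>m n n" using P[of n] by (intro eq_matI) auto
  then show "upper_triangular X \<and> nilpotent_mat X"
    using X z by (auto simp: upper_triangular_def nilpotent_mat_def)
qed

end

(* Delete the last row and column of a strictly upper-triangular X: then X is a matrix A bordered by
   a column v. Since X^(k+1) is A^(k+1) bordered by A^k v, the kernel of X^(k+1) is CARD('a) times as
   large as that of A^(k+1) if A^k v lies in the image of A^(k+1), and equally large otherwise.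
   Kernel sizes of powers determine the Jordan type, so X has the type of A with one box added, in
   column k + 1 for the least k of the first kind, and the number of v giving each column comes
   from the fibres of A^k. On the other side, n + 1 is put into a block of a set partition of [n] or
   forms a new block. The weights of the blocks of size j > 0 are the terms of a telescoping sum for the
   number of v that lead to column j + 1, so sums over matrices of a function of the Jordan
   type and weighted sums over set partitions of the same function of the partition type satisfy
   the same recursion. *)

theory Submission
  imports
    Defs
    "Jordan_Normal_Form.Jordan_Normal_Form_Existence"
    "Jordan_Normal_Form.Jordan_Normal_Form_Uniqueness"
begin

section \<open>Integer partitions and adding boxes\<close>

text \<open>The number of boxes in the first \<open>k\<close> columns of the Young diagram with rows
  \<open>xs\<close>; for a Jordan type this is the dimension of the kernel of the
  \<open>k\<close>-th power.\<close>

definition truncated_sum :: "nat \<Rightarrow> nat list \<Rightarrow> nat" where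
  "truncated_sum k xs = sum_list (map (min k) xs)"

text \<open>The length of column k + 1, that is, a part of the conjugate partition.\<close>

definition parts_above :: "nat \<Rightarrow> nat list \<Rightarrow> nat" where
  "parts_above k xs = length (filter (\<lambda>x. k < x) xs)"

lemma truncated_sum_0: "truncated_sum 0 xs = 0"
  by (induction xs) (simp_all add: truncated_sum_def)

lemma truncated_sum_Suc: "truncated_sum (Suc k) xs = truncated_sum k xs + parts_above k xs"
  by (induction xs) (auto simp: truncated_sum_def parts_above_def)

lemma truncated_sum_cong_mset: "mset xs = mset ys \<Longrightarrow> truncated_sum k xs = truncated_sum k ys"
  unfolding truncated_sum_def by (metis mset_map sum_mset_sum_list)

lemma parts_above_le_length: "parts_above k xs \<le> length xs"
  by (simp add: parts_above_def)

text \<open>Both sides say that the box in row \<open>i\<close> and column \<open>k\<close>, counted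
  from 0, lies in the diagram. Because the list is sorted, a head of at most \<open>k\<close> leaves
  no larger entry behind it.\<close>

lemma less_nth_iff_less_parts_above:
  assumes "sorted_wrt (\<ge>) xs" "i < length xs"
  shows "k < xs ! i \<longleftrightarrow> i < parts_above k xs"
  using assms
proof (induction xs arbitrary: i)
  case (Cons x xs)
  show ?case
  proof (cases "k < x")
    case True
    then show ?thesis using Cons by (cases i) (auto simp: parts_above_def)
  next
    case False
    then have "\<not> k < y" if "y \<in> set (x # xs)" for y
      using Cons.prems(1) that by fastforce
    then have "parts_above k (x # xs) = 0" "\<not> k < (x # xs) ! i"
      using nth_mem[OF Cons.prems(2)] by (simp_all add: parts_above_def filter_empty_conv)
    then show ?thesis by simp
  qed
qed simp

text \<open>Differences of consecutive truncated sums are the column lengths, and these determine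
  the rows. As all parts are positive, the first column gives the number of parts.\<close>

lemma partition_eqI:
  assumes "is_partition m xs" "is_partition n ys"
    and "\<And>k. truncated_sum k xs = truncated_sum k ys"
  shows "xs = ys"
proof (rule nth_equalityI)
  have above: "parts_above k xs = parts_above k ys" for k
    using assms(3)[of k] assms(3)[of "Suc k"] by (simp add: truncated_sum_Suc)
  have "filter (\<lambda>x. 0 < x) xs = xs" "filter (\<lambda>x. 0 < x) ys = ys"
    using assms(1,2) by (auto simp: is_partition_def filter_id_conv)
  then show len: "length xs = length ys" using above[of 0] by (simp add: parts_above_def)
  show "xs ! i = ys ! i" if "i < length xs" for i
  proof -
    have "k < xs ! i \<longleftrightarrow> k < ys ! i" for k
      using less_nth_iff_less_parts_above[of xs i k] less_nth_iff_less_parts_above[of ys i k]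
        assms(1,2) above[of k] that len by (simp add: is_partition_def)
    from this[of "xs ! i"] this[of "ys ! i"] show ?thesis by simp
  qed
qed

section \<open>Adding a box, and the weights of the rows\<close>

text \<open>Rows are counted from 0, and row \<open>length lam\<close> is the first empty one.\<close>

definition row_length :: "nat list \<Rightarrow> nat \<Rightarrow> nat" where
  "row_length lam r = (if r < length lam then lam ! r else 0)"

text \<open>Sorting allows any row to be chosen: if several rows have the same length, the longer
  row moves up to the first of them. So \<open>r\<close> can be the position of an arbitrary block
  of a set partition.\<close>

definition add_box :: "nat list \<Rightarrow> nat \<Rightarrow> nat list" where
  "add_box lam r =
    rev (sort (if r < length lam then lam[r := Suc (lam ! r)] else lam @ [1]))"

text \<open>The factor contributed by n + 1 when it joins the block at position \<open>r\<close> of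
  a set partition of [n] with \<open>l\<close> blocks; \<open>r = l\<close> stands for a new
  block.\<close>

definition box_weight :: "nat \<Rightarrow> nat \<Rightarrow> int \<Rightarrow> nat \<Rightarrow> int" where
  "box_weight n l q r = (if r < l then (q - 1) * q ^ (n - Suc r) else q ^ (n - l))"

lemma sorted_wrt_ge_rev_sort: "sorted_wrt (\<ge>) (rev (sort (xs :: nat list)))"
  unfolding sorted_wrt_rev by (rule sorted_sort)

lemma mset_add_box:
  "mset (add_box lam r) = mset (if r < length lam then lam[r := Suc (lam ! r)] else lam @ [1])"
  by (simp add: add_box_def)

lemma is_partition_add_box:
  assumes "is_partition n lam"
  shows "is_partition (Suc n) (add_box lam r)"
proof -
  let ?xs = "if r < length lam then lam[r := Suc (lam ! r)] else lam @ [1]"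
  have "sum_list (add_box lam r) = sum_list ?xs" by (metis mset_add_box sum_mset_sum_list)
  also have "\<dots> = Suc n" using assms member_le_sum_list[of "lam ! r" lam]
    by (auto simp: is_partition_def sum_list_update)
  finally have "sum_list (add_box lam r) = Suc n" .
  moreover have "set (add_box lam r) = set ?xs" by (metis mset_add_box set_mset_mset)
  then have "\<forall>k\<in>set (add_box lam r). 0 < k"
    using assms set_update_subset_insert[of lam r "Suc (lam ! r)"]
    by (auto simp: is_partition_def split: if_splits)
  ultimately show ?thesis
    using sorted_wrt_ge_rev_sort by (simp add: is_partition_def add_box_def)
qed

text \<open>The new box has \<open>row_length lam r\<close> boxes to its left, so the first
  \<open>k\<close> columns contain it exactly if that number is below \<open>k\<close>.\<close>

lemma truncated_sum_add_box:
  "truncated_sum k (add_box lam r) = truncated_sum k lam + (if row_length lam r < k then 1 else 0)"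
proof -
  have "truncated_sum k (add_box lam r) =
      truncated_sum k (if r < length lam then lam[r := Suc (lam ! r)] else lam @ [1])"
    by (rule truncated_sum_cong_mset) (rule mset_add_box)
  also have "\<dots> = truncated_sum k lam + (if row_length lam r < k then 1 else 0)"
  proof (cases "r < length lam")
    case True
    \<comment> \<open>This makes the subtraction of natural numbers in
      \<open>sum_list_update\<close> exact.\<close>
    have "min k (lam ! r) \<le> sum_list (map (min k) lam)"
      using True by (intro member_le_sum_list) auto
    then show ?thesis
      using True by (auto simp: truncated_sum_def row_length_def map_update sum_list_update)
  qed (auto simp: truncated_sum_def row_length_def)
  finally show ?thesis .
qed

lemma length_le_if_is_partition:
  assumes "is_partition n lam"
  shows "length lam \<le> n"
proof -
  have "length xs \<le> sum_list xs" if "\<forall>k\<in>set xs. 0 < k" for xs :: "nat list"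
    using that by (induction xs) auto
  then show ?thesis using assms by (auto simp: is_partition_def)
qed

text \<open>The sum telescopes, since (q - 1) q^(n-r-1) = q^(n-r) - q^(n-r-1), and the weight
  q^(n-l) of the new row cancels the last subtracted power.\<close>

lemma sum_box_weight:
  assumes "c \<le> l" "l \<le> n"
  shows "(\<Sum>r\<in>{c..l}. box_weight n l q r) = q ^ (n - c)"
  using assms(1)
proof (induction rule: inc_induct)
  case base
  then show ?case by (simp add: box_weight_def)
next
  case (step c)
  have "(\<Sum>r\<in>{c..l}. box_weight n l q r) = box_weight n l q c + (\<Sum>r\<in>{Suc c..l}. box_weight n l q r)"
    using step(2) by (simp add: sum.atLeast_Suc_atMost)
  also have "\<dots> = (q - 1) * q ^ (n - Suc c) + q ^ (n - Suc c)"
    using step by (simp add: box_weight_def)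
  also have "\<dots> = q * q ^ (n - Suc c)" by (simp add: algebra_simps)
  also have "\<dots> = q ^ (n - c)"
    using step(2) assms(2) by (simp flip: power_Suc add: Suc_diff_Suc)
  finally show ?case .
qed

text \<open>The rows of length at most \<open>j\<close> form a final segment that starts at row
  \<open>parts_above j lam\<close> and ends with the empty row \<open>length lam\<close>.\<close>

lemma sum_box_weight_row_length_le:
  assumes "is_partition n lam"
  shows "(\<Sum>r\<in>{r\<in>{..length lam}. row_length lam r \<le> j}. box_weight n (length lam) q r) =
    q ^ (n - parts_above j lam)"
proof -
  have "r < parts_above j lam \<longleftrightarrow> j < row_length lam r" if "r \<le> length lam" for r
    using less_nth_iff_less_parts_above[of lam r j] parts_above_le_length[of j lam] assms that
    by (cases "r = length lam") (auto simp: row_length_def is_partition_def)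
  then have "{r\<in>{..length lam}. row_length lam r \<le> j} = {parts_above j lam..length lam}"
    by (auto simp flip: not_less)
  then show ?thesis
    using sum_box_weight[OF parts_above_le_length length_le_if_is_partition[OF assms]] by simp
qed

section \<open>Comparing weighted sums through sublevel sets\<close>

lemma sum_sublevel_Suc:
  fixes u :: "'a \<Rightarrow> nat"
  assumes "finite C"
  shows "(\<Sum>x\<in>{x\<in>C. u x \<le> Suc j}. c x) =
    (\<Sum>x\<in>{x\<in>C. u x \<le> j}. c x) + (\<Sum>x\<in>{x\<in>C. u x = Suc j}. c x)"
  using assms by (subst sum.union_disjoint[symmetric]) (auto intro!: sum.cong)

text \<open>Level sums are differences of sublevel sums, so \<open>f\<close> and \<open>h\<close>
  push the weights \<open>a\<close> and \<open>b\<close> forward to the same weights on the natural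
  numbers. Grouping both sums by levels then gives the claim. It lets border vectors be compared
  with rows without a map between them.\<close>

lemma sum_comp_eq_if_sublevel_sums_eq:
  fixes a :: "'a \<Rightarrow> int" and b :: "'b \<Rightarrow> int" and f :: "'a \<Rightarrow> nat" and h :: "'b \<Rightarrow> nat"
  assumes "finite A" "finite B"
    and sub: "\<And>j. (\<Sum>x\<in>{x\<in>A. f x \<le> j}. a x) = (\<Sum>y\<in>{y\<in>B. h y \<le> j}. b y)"
  shows "(\<Sum>x\<in>A. a x * G (f x)) = (\<Sum>y\<in>B. b y * G (h y))"
proof -
  have level: "(\<Sum>x\<in>{x\<in>A. f x = j}. a x) = (\<Sum>y\<in>{y\<in>B. h y = j}. b y)" for j
  proof (cases j)
    case 0
    then show ?thesis using sub[of 0] by simp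
  next
    case (Suc i)
    then show ?thesis
      using sub[of i] sub[of j] sum_sublevel_Suc[OF assms(1), of a f i]
        sum_sublevel_Suc[OF assms(2), of b h i]
      by simp
  qed
  define T where "T = f ` A \<union> h ` B"
  have T: "finite T" using assms by (simp add: T_def)
  have "(\<Sum>x\<in>A. a x * G (f x)) = (\<Sum>j\<in>T. \<Sum>x\<in>{x\<in>A. f x = j}. a x * G (f x))"
    by (rule sum.group[symmetric]) (use assms T in \<open>auto simp: T_def\<close>)
  also have "\<dots> = (\<Sum>j\<in>T. (\<Sum>x\<in>{x\<in>A. f x = j}. a x) * G j)"
    by (simp add: sum_distrib_right)
  also have "\<dots> = (\<Sum>j\<in>T. (\<Sum>y\<in>{y\<in>B. h y = j}. b y) * G j)" by (simp add: level)
  also have "\<dots> = (\<Sum>j\<in>T. \<Sum>y\<in>{y\<in>B. h y = j}. b y * G (h y))"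
    by (simp add: sum_distrib_right)
  also have "\<dots> = (\<Sum>y\<in>B. b y * G (h y))"
    by (rule sum.group) (use assms T in \<open>auto simp: T_def\<close>)
  finally show ?thesis .
qed

section \<open>Jordan types of strictly upper-triangular matrices\<close>

lemma card_carrier_vec: "card (carrier_vec n :: 'a::finite vec set) = CARD('a) ^ n"
proof -
  have "inj_on (vec n) ({..<n} \<rightarrow>\<^sub>E (UNIV :: 'a set))"
  proof (rule inj_onI)
    fix f g :: "nat \<Rightarrow> 'a"
    assume fg: "f \<in> {..<n} \<rightarrow>\<^sub>E UNIV" "g \<in> {..<n} \<rightarrow>\<^sub>E UNIV" and eq: "vec n f = vec n g"
    have "f i = g i" if "i < n" for i
      using arg_cong[OF eq, of "\<lambda>v. v $ i"] that by simp
    then show "f = g" by (intro PiE_ext[OF fg]) simp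
  qed
  moreover have "vec n ` ({..<n} \<rightarrow>\<^sub>E (UNIV :: 'a set)) = carrier_vec n"
  proof (intro subset_antisym subsetI)
    fix v :: "'a vec"
    assume "v \<in> carrier_vec n"
    then have "v = vec n (\<lambda>i\<in>{..<n}. v $ i)" by (intro eq_vecI) auto
    then show "v \<in> vec n ` ({..<n} \<rightarrow>\<^sub>E UNIV)" by (rule image_eqI[of _ "vec n"]) simp
  next
    fix v :: "'a vec"
    assume "v \<in> vec n ` ({..<n} \<rightarrow>\<^sub>E UNIV)"
    then obtain f where "v = vec n f" by blast
    then show "v \<in> carrier_vec n" by simp
  qed
  ultimately have "bij_betw (vec n) ({..<n} \<rightarrow>\<^sub>E (UNIV :: 'a set)) (carrier_vec n)"
    by (simp add: bij_betw_def)
  then have "card (carrier_vec n :: 'a vec set) = card ({..<n} \<rightarrow>\<^sub>E (UNIV :: 'a set))"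
    using bij_betw_same_card by metis
  then show ?thesis by (simp add: card_PiE)
qed

lemma finite_carrier_vec: "finite (carrier_vec n :: 'a::finite vec set)"
  by (rule card_ge_0_finite) (simp add: card_carrier_vec)

text \<open>Coordinates with respect to a kernel basis \<open>B\<close> identify the kernel with the
  functions on \<open>B\<close>, taken extensional so that coordinates are unique.\<close>

lemma card_mat_kernel:
  fixes A :: "'a::{field,finite} mat"
  assumes "A \<in> carrier_mat nr nc"
  shows "card (mat_kernel A) = CARD('a) ^ kernel_dim A"
proof -
  interpret K: kernel nr nc A by unfold_locales (rule assms)
  obtain B where B: "finite B" "K.basis B" using kernel_basis_exists[OF assms] by blast
  then have sub: "B \<subseteq> mat_kernel A" by (simp add: K.Ker.basis_def)
  have ex1: "\<exists>!a. a \<in> B \<rightarrow>\<^sub>E UNIV \<and> K.lincomb a B = v" if "v \<in> mat_kernel A" for v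
    using that K.Ker.basis_criterion[OF B(1) sub] B(2) by auto
  have mem: "K.lincomb a B \<in> mat_kernel A" for a
    using K.Ker.lincomb_closed[OF sub] by auto
  have "bij_betw (\<lambda>a. K.lincomb a B) (B \<rightarrow>\<^sub>E (UNIV :: 'a set)) (mat_kernel A)"
  proof (rule bij_betwI')
    show "K.lincomb a B = K.lincomb b B \<longleftrightarrow> a = b"
      if "a \<in> B \<rightarrow>\<^sub>E UNIV" "b \<in> B \<rightarrow>\<^sub>E UNIV" for a b
      using ex1[OF mem[of a]] that by metis
    show "\<exists>a\<in>B \<rightarrow>\<^sub>E UNIV. v = K.lincomb a B" if "v \<in> mat_kernel A" for v
      using ex1[OF that] by metis
  qed (rule mem)
  then have "card (mat_kernel A) = card (B \<rightarrow>\<^sub>E (UNIV :: 'a set))"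
    using bij_betw_same_card by metis
  then show ?thesis using B by (simp add: card_PiE K.Ker.dim_basis)
qed

text \<open>The \<open>k\<close>-th power of a nilpotent Jordan block of size m has a kernel of
  dimension min(k, m), and the blocks add up.\<close>

lemma card_mat_kernel_pow_if_jordan_type:
  fixes X :: "'a::{field,finite} mat"
  assumes "has_jordan_type X lam"
  shows "card (mat_kernel (X ^\<^sub>m k)) = CARD('a) ^ truncated_sum k lam"
proof -
  let ?J = "map (\<lambda>k. (k, 0 :: 'a)) lam"
  have nf: "jordan_nf X ?J" using assms by (simp add: has_jordan_type_def)
  then obtain n where X: "X \<in> carrier_mat n n"
    unfolding jordan_nf_def using similar_matD by blast
  \<comment> \<open>For the eigenvalue 0 the generalised eigenspaces are the kernels of the powers
    of \<open>X\<close> itself.\<close>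
  have "char_matrix X 0 = X" using X by (intro eq_matI) (auto simp: char_matrix_def)
  then have "kernel_dim (X ^\<^sub>m k) = truncated_sum k lam"
    using dim_gen_eigenspace[OF nf, of 0 k]
    by (simp add: dim_gen_eigenspace_def truncated_sum_def filter_map o_def)
  then show ?thesis using card_mat_kernel[OF pow_carrier_mat[OF X]] by simp
qed

section \<open>Reordering the blocks of a Jordan matrix\<close>

lemma similar_four_block_swap:
  fixes A D :: "'a::comm_ring_1 mat"
  assumes A: "A \<in> carrier_mat n n" and D: "D \<in> carrier_mat m m"
  shows "similar_mat (four_block_mat A (0\<^sub>m n m) (0\<^sub>m m n) D)
    (four_block_mat D (0\<^sub>m m n) (0\<^sub>m n m) A)"
proof -
  \<comment> \<open>\<open>?P\<close> and \<open>?Q\<close> are block permutation matrices inverse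
    to each other; conjugation by them exchanges the two diagonal blocks.\<close>
  let ?P = "four_block_mat (0\<^sub>m n m) (1\<^sub>m n) (1\<^sub>m m) (0\<^sub>m m n) :: 'a mat"
  let ?Q = "four_block_mat (0\<^sub>m m n) (1\<^sub>m m) (1\<^sub>m n) (0\<^sub>m n m) :: 'a mat"
  let ?DA = "four_block_mat D (0\<^sub>m m n) (0\<^sub>m n m) A"
  have PQ: "?P * ?Q = 1\<^sub>m (n + m)"
    by (subst mult_four_block_mat[where ?nr1.0 = n and ?n1.0 = m and ?n2.0 = n and ?nr2.0 = m
          and ?nc1.0 = n and ?nc2.0 = m]) auto
  have QP: "?Q * ?P = 1\<^sub>m (n + m)"
    by (subst mult_four_block_mat[where ?nr1.0 = m and ?n1.0 = n and ?n2.0 = m and ?nr2.0 = n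
          and ?nc1.0 = m and ?nc2.0 = n]) (auto simp: add.commute[of m n])
  have PD: "?P * ?DA = four_block_mat (0\<^sub>m n m) A D (0\<^sub>m m n)"
    using A D by (subst mult_four_block_mat[where ?nr1.0 = n and ?n1.0 = m and ?n2.0 = n
          and ?nr2.0 = m and ?nc1.0 = m and ?nc2.0 = n]) auto
  have "?P * ?DA * ?Q = four_block_mat A (0\<^sub>m n m) (0\<^sub>m m n) D"
    unfolding PD using A D by (subst mult_four_block_mat[where ?nr1.0 = n and ?n1.0 = m
          and ?n2.0 = n and ?nr2.0 = m and ?nc1.0 = n and ?nc2.0 = m]) auto
  moreover have "?P \<in> carrier_mat (n + m) (n + m)" "?Q \<in> carrier_mat (n + m) (n + m)"
    by (auto simp: add.commute[of m n])
  ultimately show ?thesis using A D PQ QP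
    unfolding similar_mat_def
    by (intro exI[of _ ?P] exI[of _ ?Q] similar_mat_witI[where n = "n + m"]) auto
qed

lemma jordan_matrix_append:
  "jordan_matrix (xs @ ys) = four_block_mat (jordan_matrix xs)
    (0\<^sub>m (sum_list (map fst xs)) (sum_list (map fst ys)))
    (0\<^sub>m (sum_list (map fst ys)) (sum_list (map fst xs))) (jordan_matrix ys)"
proof -
  have "jordan_matrix (xs @ ys) = diag_block_mat
      (map (\<lambda>(n, a). jordan_block n a) xs @ map (\<lambda>(n, a). jordan_block n a) ys)"
    by (simp add: jordan_matrix_def)
  then show ?thesis unfolding diag_block_mat_append Let_def by (simp flip: jordan_matrix_def)
qed

text \<open>The head x of the first list is located in the second, and the rotation that brings it
  to the front is a single exchange of two diagonal blocks. The induction hypothesis handles the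
  blocks behind x.\<close>

lemma similar_jordan_matrix_if_mset_eq:
  fixes xs ys :: "(nat \<times> 'a::comm_ring_1) list"
  assumes "mset xs = mset ys"
  shows "similar_mat (jordan_matrix xs) (jordan_matrix ys)"
  using assms
proof (induction xs arbitrary: ys)
  case Nil
  then show ?case by (auto intro!: similar_mat_refl)
next
  case (Cons x xs)
  then obtain ys1 ys2 where ys: "ys = ys1 @ x # ys2"
    by (metis list.set_intros(1) mset_eq_setD split_list)
  then have "mset xs = mset (ys2 @ ys1)" using Cons.prems by (simp add: union_commute)
  then have IH: "similar_mat (jordan_matrix xs) (jordan_matrix (ys2 @ ys1))" by (rule Cons.IH)
  let ?sz = "\<lambda>zs :: (nat \<times> 'a) list. sum_list (map fst zs)"
  have sz: "?sz (ys2 @ ys1) = ?sz xs"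
    using \<open>mset xs = mset (ys2 @ ys1)\<close> by (metis mset_map sum_mset_sum_list)
  have "similar_mat (jordan_matrix ([x] @ xs)) (jordan_matrix ([x] @ (ys2 @ ys1)))"
    unfolding jordan_matrix_append[of "[x]" xs] jordan_matrix_append[of "[x]" "ys2 @ ys1"] sz
    by (rule similar_mat_four_block_0_0[OF similar_mat_refl IH]) auto
  moreover have "similar_mat (jordan_matrix ((x # ys2) @ ys1)) (jordan_matrix (ys1 @ (x # ys2)))"
    unfolding jordan_matrix_append by (rule similar_four_block_swap) auto
  ultimately have "similar_mat (jordan_matrix (x # xs)) (jordan_matrix (ys1 @ x # ys2))"
    unfolding append_Cons append_Nil by (rule similar_mat_trans)
  then show ?case by (simp only: ys)
qed

section \<open>Strictly upper-triangular matrices and their types\<close>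

definition strictly_upper :: "nat \<Rightarrow> 'a::zero mat set" where
  "strictly_upper n = {X \<in> carrier_mat n n. \<forall>i<n. \<forall>j\<le>i. X $$ (i, j) = 0}"

text \<open>Triangular matrices have a Jordan normal form over any field. Here the characteristic
  polynomial is a power of the variable, so all eigenvalues are 0; sorting the blocks turns their
  sizes into a partition.\<close>

lemma strictly_upper_has_jordan_type:
  fixes X :: "'a::field mat"
  assumes "X \<in> strictly_upper n"
  shows "\<exists>lam. is_partition n lam \<and> has_jordan_type X lam"
proof -
  have X: "X \<in> carrier_mat n n" and z: "\<And>i j. i < n \<Longrightarrow> j \<le> i \<Longrightarrow> X $$ (i, j) = 0"
    using assms by (auto simp: strictly_upper_def)
  have ut: "upper_triangular X" using X z by (auto simp: upper_triangular_def)
  obtain nas where nf: "jordan_nf X nas" using triangular_to_jnf_vector[OF X ut] by blast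
  have "char_poly X = (\<Prod>a \<leftarrow> diag_mat X. [:- a, 1:])"
    by (rule char_poly_upper_triangular[OF X ut])
  also have "diag_mat X = map (\<lambda>i. 0) [0..<n]" using X z by (auto simp: diag_mat_def)
  also have "(\<Prod>a \<leftarrow> map (\<lambda>i. 0 :: 'a) [0..<n]. [:- a, 1:]) = [:0, 1:] ^ n"
    by (simp add: o_def map_replicate_const prod_list_replicate)
  finally have cp: "char_poly X = [:0, 1:] ^ n" .
  \<comment> \<open>A block of positive size contributes to the characteristic polynomial a factor
    that vanishes at its eigenvalue.\<close>
  have ev: "a = 0" if "(m, a) \<in> set nas" for m a
  proof -
    have "0 < m" using nf that by (force simp: jordan_nf_def)
    have "[:- a, 1:] ^ m dvd (\<Prod>(m, a) \<leftarrow> nas. [:- a, 1:] ^ m)"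
      using that by (intro prod_list_dvd) force
    then have "[:- a, 1:] dvd [:0, 1:] ^ n"
      using \<open>0 < m\<close> jordan_nf_char_poly[OF nf] cp by (metis dvd_power dvd_trans)
    then have "poly ([:0, 1:] ^ n) a = 0" by (simp only: poly_eq_0_iff_dvd)
    then show "a = 0" by (simp add: poly_power)
  qed
  define lam where "lam = rev (sort (map fst nas))"
  have "map (\<lambda>k. (k, 0)) (map fst nas) = nas" using ev by (auto intro!: map_idI simp: o_def)
  then have ms: "mset (map (\<lambda>k. (k, 0)) lam) = mset nas"
    by (metis lam_def mset_map mset_rev mset_sort)
  have sim: "similar_mat X (jordan_matrix (map (\<lambda>k. (k, 0)) lam))"
    using nf similar_mat_trans[OF _ similar_jordan_matrix_if_mset_eq[OF ms[symmetric]]]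
    by (simp add: jordan_nf_def)
  have "jordan_nf X (map (\<lambda>k. (k, 0)) lam)"
    using nf sim mset_eq_setD[OF ms] by (simp add: jordan_nf_def)
  moreover have "sum_list lam = n"
  proof -
    \<comment> \<open>Similar matrices have the same dimension, and that of a Jordan matrix is the
      sum of its block sizes.\<close>
    obtain m where "{X, jordan_matrix (map (\<lambda>k. (k, 0)) lam)} \<subseteq> carrier_mat m m"
      using similar_matD[OF sim] by blast
    then have "jordan_matrix (map (\<lambda>k. (k, 0 :: 'a)) lam) \<in> carrier_mat m m"
      and "X \<in> carrier_mat m m" by simp_all
    then have "dim_row (jordan_matrix (map (\<lambda>k. (k, 0 :: 'a)) lam)) = n"
      using X by (metis carrier_matD(1))
    then show ?thesis by (simp add: o_def)
  qed
  moreover have "\<forall>k\<in>set lam. 0 < k"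
    using nf by (auto simp: lam_def jordan_nf_def image_iff simp flip: neq0_conv)
  moreover have "sorted_wrt (\<ge>) lam" unfolding lam_def by (rule sorted_wrt_ge_rev_sort)
  ultimately have "is_partition n lam \<and> has_jordan_type X lam"
    by (simp add: is_partition_def has_jordan_type_def)
  then show ?thesis by blast
qed

text \<open>\<open>is_partition\<close> selects the weakly decreasing one among all orders of the
  Jordan blocks.\<close>

definition jordan_type :: "'a::semiring_1 mat \<Rightarrow> nat list" where
  "jordan_type X = (THE lam. is_partition (dim_row X) lam \<and> has_jordan_type X lam)"

lemma one_less_CARD_field: "1 < CARD('a::{field,finite})"
  using card_mono[of UNIV "{0, 1 :: 'a}"] by simp

text \<open>As \<open>CARD('a)\<close> exceeds 1, the kernel sizes determine all truncated sums and
  hence, by \<open>partition_eqI\<close>, the only type that \<open>X\<close> can have. That it has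
  one is \<open>strictly_upper_has_jordan_type\<close>.\<close>

lemma jordan_type_eqI:
  fixes X :: "'a::{field,finite} mat"
  assumes "X \<in> strictly_upper n" "is_partition n lam"
    and "\<And>k. card (mat_kernel (X ^\<^sub>m k)) = CARD('a) ^ truncated_sum k lam"
  shows "jordan_type X = lam"
proof -
  have *: "mu = lam" if "is_partition n mu" "has_jordan_type X mu" for mu
  proof (rule partition_eqI[OF that(1) assms(2)])
    show "truncated_sum k mu = truncated_sum k lam" for k
      using card_mat_kernel_pow_if_jordan_type[OF that(2), of k] assms(3)[of k]
        one_less_CARD_field[where 'a = 'a] by simp
  qed
  obtain mu where "is_partition n mu" "has_jordan_type X mu"
    using strictly_upper_has_jordan_type[OF assms(1)] by blast
  then have lam: "is_partition n lam" "has_jordan_type X lam" using *[of mu] by simp_all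
  moreover have "dim_row X = n" using assms(1) by (auto simp: strictly_upper_def)
  ultimately show "jordan_type X = lam"
    unfolding jordan_type_def using * by (blast intro: the_equality)
qed

lemma jordan_type:
  fixes X :: "'a::{field,finite} mat"
  assumes "X \<in> strictly_upper n"
  shows "is_partition n (jordan_type X)" "has_jordan_type X (jordan_type X)"
proof -
  obtain lam where lam: "is_partition n lam" "has_jordan_type X lam"
    using strictly_upper_has_jordan_type[OF assms] by blast
  have "jordan_type X = lam"
    by (rule jordan_type_eqI[OF assms lam(1) card_mat_kernel_pow_if_jordan_type[OF lam(2)]])
  then show "is_partition n (jordan_type X)" "has_jordan_type X (jordan_type X)"
    using lam by simp_all
qed

text \<open>This replaces the predicates of the definition by the function
  \<open>jordan_type\<close>, so that counting becomes a sum over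
  \<open>strictly_upper n\<close>.\<close>

lemma upper_nilpotents_of_type_eq:
  assumes "is_partition n lam"
  shows "(upper_nilpotents_of_type n lam :: 'a::{field,finite} mat set) =
    {X \<in> strictly_upper n. jordan_type X = lam}"
proof -
  have "upper_nilpotents_of_type n lam = {X :: 'a mat. X \<in> strictly_upper n \<and> has_jordan_type X lam}"
    unfolding upper_nilpotents_of_type_def strictly_upper_def
    using upper_triangular_nilpotent_iff by auto
  then show ?thesis
    using jordan_type_eqI[OF _ assms card_mat_kernel_pow_if_jordan_type] jordan_type(2)
    by auto
qed

section \<open>Bordered matrices\<close>

lemma pow_mat_Suc_left:
  fixes A :: "'a::semiring_1 mat"
  assumes A: "A \<in> carrier_mat n n"
  shows "A ^\<^sub>m Suc k = A * A ^\<^sub>m k"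
proof (induction k)
  case 0
  then show ?case using A by simp
next
  case (Suc k)
  have "A ^\<^sub>m Suc (Suc k) = A * A ^\<^sub>m k * A" using Suc by simp
  also have "\<dots> = A * (A ^\<^sub>m k * A)"
    by (rule assoc_mult_mat[OF A pow_carrier_mat[OF A] A])
  finally show ?case by simp
qed

text \<open>A nonempty fibre is a translate of the kernel.\<close>

lemma card_fibre_mult_mat_vec:
  fixes M :: "'a::{field,finite} mat"
  assumes M: "M \<in> carrier_mat n n" and y: "y \<in> (*\<^sub>v) M ` carrier_vec n"
  shows "card {x \<in> carrier_vec n. M *\<^sub>v x = y} = card (mat_kernel M)"
proof -
  obtain x0 where x0: "x0 \<in> carrier_vec n" "M *\<^sub>v x0 = y" using y by blast
  have "bij_betw (\<lambda>z. x0 + z) (mat_kernel M) {x \<in> carrier_vec n. M *\<^sub>v x = y}"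
  proof (rule bij_betwI[where g = "\<lambda>x. x - x0"])
    show "(\<lambda>z. x0 + z) \<in> mat_kernel M \<rightarrow> {x \<in> carrier_vec n. M *\<^sub>v x = y}"
    proof
      fix z
      assume "z \<in> mat_kernel M"
      then have "z \<in> carrier_vec n" "M *\<^sub>v z = 0\<^sub>v n" by (rule mat_kernelD[OF M])+
      then show "x0 + z \<in> {x \<in> carrier_vec n. M *\<^sub>v x = y}"
        using x0 M mult_mat_vec_carrier[OF M x0(1)] by (simp add: mult_add_distrib_mat_vec[OF M])
    qed
    show "(\<lambda>x. x - x0) \<in> {x \<in> carrier_vec n. M *\<^sub>v x = y} \<rightarrow> mat_kernel M"
    proof
      fix x
      assume "x \<in> {x \<in> carrier_vec n. M *\<^sub>v x = y}"
      then show "x - x0 \<in> mat_kernel M"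
        using x0 mult_mat_vec_carrier[OF M x0(1)]
        by (intro mat_kernelI[OF M]) (simp_all add: mult_minus_distrib_mat_vec[OF M])
    qed
    show "x0 + z - x0 = z" if "z \<in> mat_kernel M" for z
      using mat_kernelD(1)[OF M that] x0(1) by (intro eq_vecI) auto
    show "x0 + (x - x0) = x" if "x \<in> {x \<in> carrier_vec n. M *\<^sub>v x = y}" for x
      using that x0(1) by (intro eq_vecI) auto
  qed
  then show ?thesis by (metis bij_betw_same_card)
qed

text \<open>The preimage is a disjoint union of fibres. With \<open>T\<close> the whole image this
  is rank-nullity in counting form; with \<open>T\<close> the image of the next power it counts
  border vectors.\<close>

lemma card_vimage_mult_mat_vec:
  fixes M :: "'a::{field,finite} mat"
  assumes M: "M \<in> carrier_mat n n" and T: "T \<subseteq> (*\<^sub>v) M ` carrier_vec n"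
  shows "card {x \<in> carrier_vec n. M *\<^sub>v x \<in> T} = card T * card (mat_kernel M)"
proof -
  have fin: "finite T" by (rule finite_subset[OF T]) (simp add: finite_carrier_vec)
  have "{x \<in> carrier_vec n. M *\<^sub>v x \<in> T} = (\<Union>y\<in>T. {x \<in> carrier_vec n. M *\<^sub>v x = y})" by blast
  also have "card \<dots> = (\<Sum>y\<in>T. card {x \<in> carrier_vec n. M *\<^sub>v x = y})"
    using fin by (intro card_UN_disjoint) (auto simp: finite_carrier_vec)
  also have "\<dots> = (\<Sum>y\<in>T. card (mat_kernel M))"
    using T by (intro sum.cong card_fibre_mult_mat_vec[OF M]) auto
  finally show ?thesis by simp
qed

section \<open>Powers and kernels of bordered matrices\<close>

definition border :: "'a::zero mat \<Rightarrow> 'a vec \<Rightarrow> 'a mat" where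
  "border A v = four_block_mat A (mat (dim_vec v) 1 (\<lambda>(i, j). v $ i))
    (0\<^sub>m 1 (dim_vec v)) (0\<^sub>m 1 1)"

lemma border_carrier:
  "A \<in> carrier_mat n n \<Longrightarrow> v \<in> carrier_vec n \<Longrightarrow> border A v \<in> carrier_mat (Suc n) (Suc n)"
  using four_block_carrier_mat[of A n n "0\<^sub>m 1 1" 1 1] by (simp add: border_def)

text \<open>The last row of \<open>border B w\<close> is zero, so the column \<open>u\<close> drops
  out of the product.\<close>

lemma border_mult:
  fixes A B :: "'a::semiring_1 mat"
  assumes A: "A \<in> carrier_mat n n" and B: "B \<in> carrier_mat n n"
    and u: "u \<in> carrier_vec n" and w: "w \<in> carrier_vec n"
  shows "border A u * border B w = border (A * B) (A *\<^sub>v w)"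
proof -
  let ?c = "\<lambda>v :: 'a vec. mat n 1 (\<lambda>(i, j). v $ i)"
  have c: "?c v \<in> carrier_mat n 1" for v by simp
  have d: "dim_vec u = n" "dim_vec w = n" "dim_vec (A *\<^sub>v w) = n" using A u w by auto
  have w_eta: "vec n (($) w) = w" using w by (intro eq_vecI) auto
  have Aw: "A * ?c w = ?c (A *\<^sub>v w)"
    using A w by (intro eq_matI) (auto simp: w_eta)
  show ?thesis
    unfolding border_def d
    by (subst mult_four_block_mat[OF A c _ _ B c]) (use A B Aw in auto)
qed

text \<open>Only positive exponents qualify: the zeroth power is the identity, whose last row is not
  zero.\<close>

lemma border_pow:
  fixes A :: "'a::semiring_1 mat"
  assumes A: "A \<in> carrier_mat n n" and v: "v \<in> carrier_vec n"
  shows "border A v ^\<^sub>m Suc k = border (A ^\<^sub>m Suc k) (A ^\<^sub>m k *\<^sub>v v)"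
proof (induction k)
  case 0
  then show ?case using A v border_carrier[OF A v] by simp
next
  case (Suc k)
  have P: "A ^\<^sub>m k \<in> carrier_mat n n" for k by (rule pow_carrier_mat[OF A])
  have "border A v ^\<^sub>m Suc (Suc k) = border (A ^\<^sub>m Suc k) (A ^\<^sub>m k *\<^sub>v v) * border A v"
    using Suc by simp
  also have "\<dots> = border (A ^\<^sub>m Suc k * A) (A ^\<^sub>m Suc k *\<^sub>v v)"
    by (rule border_mult[OF P A mult_mat_vec_carrier[OF P v] v])
  finally show ?case by simp
qed

lemma border_mult_vec:
  fixes M :: "'a::comm_ring_1 mat"
  assumes M: "M \<in> carrier_mat n n" and u: "u \<in> carrier_vec n" and x: "x \<in> carrier_vec n"
  shows "border M u *\<^sub>v (x @\<^sub>v vec 1 (\<lambda>_. t)) = (M *\<^sub>v x + t \<cdot>\<^sub>v u) @\<^sub>v 0\<^sub>v 1"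
proof -
  let ?c = "mat n 1 (\<lambda>(i, j). u $ i)"
  have "?c *\<^sub>v vec 1 (\<lambda>_. t) = t \<cdot>\<^sub>v u"
    using u by (intro eq_vecI) (auto simp: scalar_prod_def mult.commute)
  moreover have "0\<^sub>m 1 n *\<^sub>v x + 0\<^sub>m 1 1 *\<^sub>v vec 1 (\<lambda>_. t) = 0\<^sub>v 1" using x by auto
  moreover have "dim_vec u = n" using u by simp
  ultimately show ?thesis
    unfolding border_def using x
    by (subst four_block_mat_mult_vec[OF M, of _ 1 _ 1]) auto
qed

text \<open>A kernel vector consists of x and a last coordinate t with M x = -t u. For t = 0 the
  solutions x form the kernel of \<open>M\<close>; for each other t they form a translate of it if
  \<open>u\<close> lies in the image, and there are none otherwise.\<close>

lemma card_mat_kernel_border: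
  fixes M :: "'a::{field,finite} mat"
  assumes M: "M \<in> carrier_mat n n" and u: "u \<in> carrier_vec n"
  shows "card (mat_kernel (border M u)) =
    (if u \<in> (*\<^sub>v) M ` carrier_vec n then CARD('a) else 1) * card (mat_kernel M)"
proof -
  let ?I = "(*\<^sub>v) M ` carrier_vec n"
  let ?K = "\<lambda>t. {x \<in> carrier_vec n. M *\<^sub>v x + t \<cdot>\<^sub>v u = 0\<^sub>v n}"
  have Mx: "M *\<^sub>v x \<in> carrier_vec n" for x using M by (intro carrier_vecI) auto
  have eq_iff: "M *\<^sub>v x + t \<cdot>\<^sub>v u = 0\<^sub>v n \<longleftrightarrow> M *\<^sub>v x = (- t) \<cdot>\<^sub>v u" for x t
  proof
    assume *: "M *\<^sub>v x + t \<cdot>\<^sub>v u = 0\<^sub>v n"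
    show "M *\<^sub>v x = (- t) \<cdot>\<^sub>v u"
    proof (rule eq_vecI)
      fix i
      assume "i < dim_vec ((- t) \<cdot>\<^sub>v u)"
      then have "i < n" using u by simp
      then have "(M *\<^sub>v x + t \<cdot>\<^sub>v u) $ i = 0" using * by simp
      then show "(M *\<^sub>v x) $ i = ((- t) \<cdot>\<^sub>v u) $ i"
        using \<open>i < n\<close> u M by (simp add: eq_neg_iff_add_eq_0)
    qed (use M u in simp)
  next
    assume *: "M *\<^sub>v x = (- t) \<cdot>\<^sub>v u"
    show "M *\<^sub>v x + t \<cdot>\<^sub>v u = 0\<^sub>v n" unfolding * using u by (intro eq_vecI) auto
  qed
  have bij: "bij_betw (\<lambda>(t, x). x @\<^sub>v vec 1 (\<lambda>_. t)) (Sigma UNIV ?K) (mat_kernel (border M u))"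
    unfolding bij_betw_def
  proof (intro conjI inj_onI subset_antisym subsetI)
    fix p r
    assume p: "p \<in> Sigma UNIV ?K" and r: "r \<in> Sigma UNIV ?K"
      and eq: "(case p of (t, x) \<Rightarrow> x @\<^sub>v vec 1 (\<lambda>_. t)) = (case r of (t, x) \<Rightarrow> x @\<^sub>v vec 1 (\<lambda>_. t))"
    obtain t x t' x' where pr: "p = (t, x)" "r = (t', x')" by fastforce
    then have "x = x' \<and> vec 1 (\<lambda>_. t) = vec 1 (\<lambda>_. t')"
      using p r eq append_vec_eq[of x n x'] by simp
    moreover from this have "t = t'" by (metis index_vec less_one)
    ultimately show "p = r" using pr by simp
  next
    fix y
    assume "y \<in> (\<lambda>(t, x). x @\<^sub>v vec 1 (\<lambda>_. t)) ` Sigma UNIV ?K"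
    then obtain t x where x: "x \<in> carrier_vec n" "M *\<^sub>v x + t \<cdot>\<^sub>v u = 0\<^sub>v n"
      and y: "y = x @\<^sub>v vec 1 (\<lambda>_. t)" by auto
    have "border M u *\<^sub>v y = 0\<^sub>v n @\<^sub>v 0\<^sub>v 1"
      using border_mult_vec[OF M u x(1), of t] x(2) y by simp
    also have "\<dots> = 0\<^sub>v (Suc n)" by (intro eq_vecI) auto
    finally show "y \<in> mat_kernel (border M u)"
      using x(1) y by (intro mat_kernelI[OF border_carrier[OF M u]] carrier_vecI) auto
  next
    fix y
    assume "y \<in> mat_kernel (border M u)"
    then have y: "y \<in> carrier_vec (n + 1)" "border M u *\<^sub>v y = 0\<^sub>v (Suc n)"
      using mat_kernelD[OF border_carrier[OF M u]] by simp_all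
    define x t where "x = vec_first y n" and "t = vec_last y 1 $ 0"
    have x: "x \<in> carrier_vec n" by (simp add: x_def)
    have "vec_last y 1 = vec 1 (\<lambda>_. t)" by (intro eq_vecI) (auto simp: t_def)
    then have split: "y = x @\<^sub>v vec 1 (\<lambda>_. t)" using vec_first_last_append[OF y(1)] x_def by simp
    have "(M *\<^sub>v x + t \<cdot>\<^sub>v u) @\<^sub>v 0\<^sub>v 1 = 0\<^sub>v (Suc n)"
      using y(2) border_mult_vec[OF M u x, of t] split by simp
    also have "\<dots> = 0\<^sub>v n @\<^sub>v 0\<^sub>v 1" by (intro eq_vecI) auto
    finally have "M *\<^sub>v x + t \<cdot>\<^sub>v u = 0\<^sub>v n"
      using append_vec_eq[of "M *\<^sub>v x + t \<cdot>\<^sub>v u" n "0\<^sub>v n"] Mx u by simp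
    then show "y \<in> (\<lambda>(t, x). x @\<^sub>v vec 1 (\<lambda>_. t)) ` Sigma UNIV ?K"
      using x split by (intro image_eqI[where x = "(t, x)"]) simp_all
  qed
  have "card (mat_kernel (border M u)) = (\<Sum>t\<in>UNIV. card (?K t))"
    using bij_betw_same_card[OF bij] by (simp add: finite_carrier_vec)
  also have "\<dots> = (\<Sum>t\<in>(UNIV :: 'a set). if t = 0 \<or> u \<in> ?I then card (mat_kernel M) else 0)"
  proof (rule sum.cong[OF refl])
    fix t
    \<comment> \<open>The image is a subspace, so a nonzero multiple of \<open>u\<close> lies in it
      exactly if \<open>u\<close> does.\<close>
    have "(- t) \<cdot>\<^sub>v u \<in> ?I \<longleftrightarrow> t = 0 \<or> u \<in> ?I"
    proof
      assume "(- t) \<cdot>\<^sub>v u \<in> ?I"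
      then obtain x where x: "x \<in> carrier_vec n" "(- t) \<cdot>\<^sub>v u = M *\<^sub>v x" by blast
      show "t = 0 \<or> u \<in> ?I"
      proof (cases "t = 0")
        case False
        then have "u = (- inverse t) \<cdot>\<^sub>v ((- t) \<cdot>\<^sub>v u)" by (simp add: smult_smult_assoc)
        also have "\<dots> = M *\<^sub>v ((- inverse t) \<cdot>\<^sub>v x)"
          unfolding x(2) using x(1) by (simp only: mult_mat_vec[OF M])
        finally have "u \<in> ?I" by (rule image_eqI) (use x(1) in simp)
        then show ?thesis ..
      qed simp
    next
      assume "t = 0 \<or> u \<in> ?I"
      then show "(- t) \<cdot>\<^sub>v u \<in> ?I"
      proof
        assume "t = 0"
        then have "(- t) \<cdot>\<^sub>v u = M *\<^sub>v 0\<^sub>v n" using M u by (intro eq_vecI) auto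
        then show ?thesis by (rule image_eqI) simp
      next
        assume "u \<in> ?I"
        then obtain x where x: "x \<in> carrier_vec n" "u = M *\<^sub>v x" by blast
        have "(- t) \<cdot>\<^sub>v u = M *\<^sub>v ((- t) \<cdot>\<^sub>v x)" unfolding x(2) using x(1) by (simp only: mult_mat_vec[OF M])
        then show ?thesis by (rule image_eqI) (use x(1) in simp)
      qed
    qed
    moreover have "?K t = {x \<in> carrier_vec n. M *\<^sub>v x = (- t) \<cdot>\<^sub>v u}" by (simp only: eq_iff)
    moreover have "{x \<in> carrier_vec n. M *\<^sub>v x = y} = {}" if "y \<notin> ?I" for y using that by blast
    ultimately show "card (?K t) = (if t = 0 \<or> u \<in> ?I then card (mat_kernel M) else 0)"
      using card_fibre_mult_mat_vec[OF M, of "(- t) \<cdot>\<^sub>v u"] by (metis card.empty)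
  qed
  also have "\<dots> = (if u \<in> ?I then CARD('a) else 1) * card (mat_kernel M)"
    by (simp add: sum.delta)
  finally show ?thesis .
qed

lemma border_index:
  assumes A: "A \<in> carrier_mat n n" and v: "v \<in> carrier_vec n" and "i < Suc n" "j < Suc n"
  shows "border A v $$ (i, j) = (if i < n then if j < n then A $$ (i, j) else v $ i else 0)"
proof -
  have "dim_row A = n" "dim_col A = n" "dim_vec v = n" using A v by auto
  then show ?thesis using assms(3,4) by (auto simp: border_def)
qed

lemma border_strictly_upper:
  assumes "A \<in> strictly_upper n" "v \<in> carrier_vec n"
  shows "border A v \<in> strictly_upper (Suc n)"
  using assms border_carrier[of A n v]
  by (auto simp: strictly_upper_def border_index)

text \<open>The inverse cuts off the last row and reads \<open>v\<close> from the last column.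
  Nothing is lost, as the last row of a strictly upper-triangular matrix is zero.\<close>

lemma bij_betw_border:
  "bij_betw (\<lambda>(A, v). border A v) (strictly_upper n \<times> carrier_vec n) (strictly_upper (Suc n))"
proof (rule bij_betwI[where g = "\<lambda>X. (mat n n (\<lambda>(i, j). X $$ (i, j)), vec n (\<lambda>i. X $$ (i, n)))"])
  show "(\<lambda>(A, v). border A v) \<in> strictly_upper n \<times> carrier_vec n \<rightarrow> strictly_upper (Suc n)"
    by (auto simp: border_strictly_upper)
  show "(\<lambda>X. (mat n n (\<lambda>(i, j). X $$ (i, j)), vec n (\<lambda>i. X $$ (i, n)))) \<in>
      strictly_upper (Suc n) \<rightarrow> strictly_upper n \<times> carrier_vec n"
    by (auto simp: strictly_upper_def)
next
  fix p :: "'a mat \<times> 'a vec"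
  assume p: "p \<in> strictly_upper n \<times> carrier_vec n"
  obtain A v where Av: "p = (A, v)" by fastforce
  then have A: "A \<in> carrier_mat n n" and v: "v \<in> carrier_vec n"
    using p by (auto simp: strictly_upper_def)
  have "mat n n (\<lambda>(i, j). border A v $$ (i, j)) = A"
    using A v by (intro eq_matI) (auto simp: border_index)
  moreover have "vec n (\<lambda>i. border A v $$ (i, n)) = v"
    using A v by (intro eq_vecI) (auto simp: border_index)
  ultimately show "(mat n n (\<lambda>(i, j). (case p of (A, v) \<Rightarrow> border A v) $$ (i, j)),
      vec n (\<lambda>i. (case p of (A, v) \<Rightarrow> border A v) $$ (i, n))) = p"
    by (simp add: Av)
next
  fix X :: "'a mat"
  assume X: "X \<in> strictly_upper (Suc n)"
  let ?A = "mat n n (\<lambda>(i, j). X $$ (i, j))" and ?v = "vec n (\<lambda>i. X $$ (i, n))"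
  have B: "border ?A ?v \<in> carrier_mat (Suc n) (Suc n)" by (rule border_carrier) simp_all
  have "border ?A ?v = X"
  proof (rule eq_matI)
    fix i j
    assume "i < dim_row X" "j < dim_col X"
    then have "i < Suc n" "j < Suc n" using X by (auto simp: strictly_upper_def)
    then show "border ?A ?v $$ (i, j) = X $$ (i, j)"
      using X border_index[of ?A n ?v i j] by (auto simp: strictly_upper_def less_Suc_eq)
  qed (use X B in \<open>auto simp: strictly_upper_def\<close>)
  then show "(case (?A, ?v) of (A, v) \<Rightarrow> border A v) = X" by simp
qed

lemma finite_strictly_upper: "finite (strictly_upper n :: 'a::{zero,finite} mat set)"
proof (induction n)
  case 0
  have "strictly_upper 0 \<subseteq> {0\<^sub>m 0 0 :: 'a mat}" by (auto simp: strictly_upper_def intro!: eq_matI)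
  then show ?case by (rule finite_subset) simp
next
  case (Suc n)
  have "finite ((strictly_upper n :: 'a mat set) \<times> (carrier_vec n :: 'a vec set))"
    using Suc finite_carrier_vec by blast
  then show ?case using bij_betw_finite[OF bij_betw_border] by blast
qed

section \<open>The column of the new box\<close>

text \<open>The number of columns to the left of the box by which bordering with \<open>v\<close> enlarges the
  Young diagram of the Jordan type of \<open>A\<close>. For nilpotent \<open>A\<close> the set under \<open>LEAST\<close> is nonempty.\<close>

definition border_level :: "'a::semiring_1 mat \<Rightarrow> 'a vec \<Rightarrow> nat" where
  "border_level A v =
    (LEAST j. A ^\<^sub>m j *\<^sub>v v \<in> (*\<^sub>v) (A ^\<^sub>m Suc j) ` carrier_vec (dim_row A))"

text \<open>Applying \<open>A\<close> carries the condition from \<open>j\<close> to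
  \<open>Suc j\<close>, so it holds from its least exponent onwards.\<close>

lemma border_level_le_iff:
  fixes A :: "'a::field mat"
  assumes A: "A \<in> strictly_upper n" and v: "v \<in> carrier_vec n"
  shows "border_level A v \<le> j \<longleftrightarrow> A ^\<^sub>m j *\<^sub>v v \<in> (*\<^sub>v) (A ^\<^sub>m Suc j) ` carrier_vec n"
proof -
  let ?P = "\<lambda>j. A ^\<^sub>m j *\<^sub>v v \<in> (*\<^sub>v) (A ^\<^sub>m Suc j) ` carrier_vec n"
  have A': "A \<in> carrier_mat n n" using A by (simp add: strictly_upper_def)
  have P: "A ^\<^sub>m k \<in> carrier_mat n n" for k by (rule pow_carrier_mat[OF A'])
  have step: "?P (Suc j)" if Pj: "?P j" for j
  proof -
    obtain x where x: "A ^\<^sub>m j *\<^sub>v v = A ^\<^sub>m Suc j *\<^sub>v x" "x \<in> carrier_vec n"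
      using Pj by (rule imageE)
    have "A ^\<^sub>m Suc j *\<^sub>v v = A *\<^sub>v (A ^\<^sub>m j *\<^sub>v v)"
      unfolding pow_mat_Suc_left[OF A', of j] by (rule assoc_mult_mat_vec[OF A' P v])
    also have "\<dots> = A ^\<^sub>m Suc (Suc j) *\<^sub>v x"
      unfolding x(1) pow_mat_Suc_left[OF A', of "Suc j"]
      by (rule assoc_mult_mat_vec[OF A' P x(2), symmetric])
    finally show ?thesis using x(2) by (rule image_eqI)
  qed
  have "nilpotent_mat A"
    using upper_triangular_nilpotent_iff[OF A'] A by (auto simp: strictly_upper_def)
  then obtain k where "A ^\<^sub>m k = 0\<^sub>m n n" using A' by (auto simp: nilpotent_mat_def)
  \<comment> \<open>Once a power of \<open>A\<close> vanishes, the zero vector is a preimage; hence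
    a least exponent exists.\<close>
  then have "A ^\<^sub>m k *\<^sub>v v = A ^\<^sub>m Suc k *\<^sub>v 0\<^sub>v n"
    using A' v P[of "Suc k"] by (intro eq_vecI) auto
  then have "?P k" by (rule image_eqI) simp
  then have least: "?P (LEAST j. ?P j)" by (rule LeastI)
  have level: "border_level A v = (LEAST j. ?P j)" using A' by (simp add: border_level_def)
  show ?thesis
  proof
    assume "border_level A v \<le> j"
    then show "?P j"
      using least step unfolding level by (rule dec_induct)
  next
    assume "?P j"
    then show "border_level A v \<le> j" unfolding level by (rule Least_le)
  qed
qed

text \<open>For k = j + 1 the power of the bordered matrix is \<open>A ^\<^sub>m k\<close> bordered
  by A^j v. Its kernel grows by the factor \<open>CARD('a)\<close> exactly if A^j v is in the image
  of A^(j+1), that is, if the level is at most \<open>j\<close>.\<close>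

lemma truncated_sum_jordan_type_border:
  fixes A :: "'a::{field,finite} mat"
  assumes A: "A \<in> strictly_upper n" and v: "v \<in> carrier_vec n"
  shows "truncated_sum k (jordan_type (border A v)) =
    truncated_sum k (jordan_type A) + (if border_level A v < k then 1 else 0)"
proof (cases k)
  case 0
  then show ?thesis by (simp add: truncated_sum_0)
next
  case (Suc j)
  have A': "A \<in> carrier_mat n n" using A by (simp add: strictly_upper_def)
  have "CARD('a) ^ truncated_sum k (jordan_type (border A v)) =
      card (mat_kernel (border A v ^\<^sub>m Suc j))"
    using card_mat_kernel_pow_if_jordan_type[OF jordan_type(2)[OF border_strictly_upper[OF A v]], of k]
      Suc by simp
  also have "\<dots> = (if border_level A v \<le> j then CARD('a) else 1) * card (mat_kernel (A ^\<^sub>m Suc j))"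
    unfolding border_pow[OF A' v] border_level_le_iff[OF A v]
    by (rule card_mat_kernel_border[OF pow_carrier_mat[OF A']
          mult_mat_vec_carrier[OF pow_carrier_mat[OF A'] v]])
  also have "\<dots> = CARD('a) ^ (truncated_sum k (jordan_type A) + (if border_level A v < k then 1 else 0))"
    using card_mat_kernel_pow_if_jordan_type[OF jordan_type(2)[OF A], of k] Suc
    by (simp add: less_Suc_eq_le)
  finally show ?thesis using one_less_CARD_field[where 'a = 'a] by simp
qed

text \<open>The vectors in question are the preimage under A^j of the image of A^(j+1), so their
  number is the size of that image times the size of the kernel of A^j. By rank-nullity this is
  \<open>CARD('a) ^ n\<close> divided by the ratio of the kernel sizes of A^(j+1) and A^j, and the
  ratio has exponent \<open>parts_above j\<close>.\<close>

lemma card_border_level_le: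
  fixes A :: "'a::{field,finite} mat"
  assumes A: "A \<in> strictly_upper n"
  shows "card {v \<in> carrier_vec n. border_level A v \<le> j} =
    CARD('a) ^ (n - parts_above j (jordan_type A))"
proof -
  let ?mu = "jordan_type A" and ?im = "\<lambda>k. (*\<^sub>v) (A ^\<^sub>m k) ` carrier_vec n"
  have A': "A \<in> carrier_mat n n" using A by (simp add: strictly_upper_def)
  have P: "A ^\<^sub>m k \<in> carrier_mat n n" for k by (rule pow_carrier_mat[OF A'])
  have ker: "card (mat_kernel (A ^\<^sub>m k)) = CARD('a) ^ truncated_sum k ?mu" for k
    by (rule card_mat_kernel_pow_if_jordan_type[OF jordan_type(2)[OF A]])
  have sub: "?im (Suc j) \<subseteq> ?im j"
  proof
    fix y
    assume "y \<in> ?im (Suc j)"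
    then obtain x where x: "y = A ^\<^sub>m Suc j *\<^sub>v x" "x \<in> carrier_vec n" by (rule imageE)
    then have "y = A ^\<^sub>m j *\<^sub>v (A *\<^sub>v x)" using assoc_mult_mat_vec[OF P A' x(2)] by simp
    then show "y \<in> ?im j" using mult_mat_vec_carrier[OF A' x(2)] by (rule image_eqI)
  qed
  \<comment> \<open>The preimage of the whole image is the whole space, which yields rank-nullity
    for A^(j+1).\<close>
  have "{x \<in> carrier_vec n. A ^\<^sub>m Suc j *\<^sub>v x \<in> ?im (Suc j)} = carrier_vec n" by blast
  then have im: "CARD('a) ^ n = card (?im (Suc j)) * CARD('a) ^ truncated_sum (Suc j) ?mu"
    using card_vimage_mult_mat_vec[OF P[of "Suc j"] subset_refl]
    by (simp only: card_carrier_vec ker)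
  have "{v \<in> carrier_vec n. border_level A v \<le> j} =
      {v \<in> carrier_vec n. A ^\<^sub>m j *\<^sub>v v \<in> ?im (Suc j)}"
    using border_level_le_iff[OF A] by blast
  then have "card {v \<in> carrier_vec n. border_level A v \<le> j} =
      card (?im (Suc j)) * CARD('a) ^ truncated_sum j ?mu"
    using card_vimage_mult_mat_vec[OF P sub] by (simp only: ker)
  then have "card {v \<in> carrier_vec n. border_level A v \<le> j} * CARD('a) ^ parts_above j ?mu =
      CARD('a) ^ n"
    unfolding im truncated_sum_Suc power_add by simp
  moreover have "parts_above j ?mu \<le> n"
    using parts_above_le_length length_le_if_is_partition[OF jordan_type(1)[OF A]] le_trans by blast
  then have "CARD('a) ^ n = CARD('a) ^ (n - parts_above j ?mu) * CARD('a) ^ parts_above j ?mu"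
    by (simp flip: power_add)
  ultimately show ?thesis by simp
qed

text \<open>The enlarged type depends on \<open>v\<close> only through the border level and on
  \<open>r\<close> only through the row length. Sublevel sets of both have the same total weight,
  once by counting vectors and once by telescoping.\<close>

lemma sum_jordan_type_border:
  fixes A :: "'a::{field,finite} mat" and g :: "nat list \<Rightarrow> int"
  assumes A: "A \<in> strictly_upper n"
  shows "(\<Sum>v\<in>carrier_vec n. g (jordan_type (border A v))) =
    (\<Sum>r\<le>length (jordan_type A). box_weight n (length (jordan_type A)) (int CARD('a)) r *
      g (add_box (jordan_type A) r))"
proof -
  let ?mu = "jordan_type A"
  \<comment> \<open>\<open>Q j lam\<close> says that \<open>lam\<close> arises from
    \<open>?mu\<close> by a box in column j + 1; by \<open>partition_eqI\<close> there is at most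
    one such \<open>lam\<close>. If there is none, \<open>G j\<close> is unspecified, but then
    \<open>j\<close> is neither the level of a vector nor a row length.\<close>
  define Q where "Q j lam \<longleftrightarrow> is_partition (Suc n) lam \<and>
    (\<forall>k. truncated_sum k lam = truncated_sum k ?mu + (if j < k then 1 else 0))" for j lam
  define G where "G j = g (THE lam. Q j lam)" for j
  have G: "G j = g lam" if "Q j lam" for j lam
  proof -
    have "lam' = lam" if "Q j lam'" for lam'
      using that \<open>Q j lam\<close> unfolding Q_def by (intro partition_eqI[of "Suc n" _ "Suc n"]) simp_all
    then have "(THE lam. Q j lam) = lam" using that by (rule the_equality[rotated])
    then show ?thesis by (simp add: G_def)
  qed
  have border: "Q (border_level A v) (jordan_type (border A v))" if "v \<in> carrier_vec n" for v
    unfolding Q_def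
    using truncated_sum_jordan_type_border[OF A that]
      jordan_type(1)[OF border_strictly_upper[OF A that]]
    by simp
  have box: "Q (row_length ?mu r) (add_box ?mu r)" for r
    unfolding Q_def using truncated_sum_add_box is_partition_add_box[OF jordan_type(1)[OF A]] by simp
  have "(\<Sum>v\<in>carrier_vec n. g (jordan_type (border A v))) =
      (\<Sum>v\<in>carrier_vec n. 1 * G (border_level A v))"
    by (intro sum.cong refl) (simp add: G[OF border])
  also have "\<dots> = (\<Sum>r\<le>length ?mu. box_weight n (length ?mu) (int CARD('a)) r * G (row_length ?mu r))"
  proof (rule sum_comp_eq_if_sublevel_sums_eq)
    show "(\<Sum>v\<in>{v \<in> carrier_vec n. border_level A v \<le> j}. 1) =
        (\<Sum>r\<in>{r \<in> {..length ?mu}. row_length ?mu r \<le> j}.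
          box_weight n (length ?mu) (int CARD('a)) r)" for j
      unfolding sum_box_weight_row_length_le[OF jordan_type(1)[OF A]]
      by (simp add: card_border_level_le[OF A])
  qed (simp_all add: finite_carrier_vec)
  finally show ?thesis by (simp only: G[OF box])
qed

section \<open>Extending set partitions\<close>

lemma blocks:
  assumes "finite A" "partition_on A S"
  shows "set (blocks S) = S" "sorted_wrt block_before (blocks S)"
  using theI'[OF blocks_unique[OF assms]] by (simp_all add: blocks_def)

lemma distinct_blocks:
  assumes "finite A" "partition_on A S"
  shows "distinct (blocks S)"
  using blocks(2)[OF assms] by (auto simp: distinct_conv_nth sorted_wrt_iff_nth_less
      block_before_def elim!: linorder_neqE_nat) (metis less_irrefl)+

lemma mset_partition_type:
  assumes "finite A" "partition_on A S"
  shows "mset (partition_type S) = image_mset card (mset_set S)"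
  using mset_set_set[OF distinct_blocks[OF assms]] blocks(1)[OF assms]
  by (simp add: partition_type_def)

lemma sorted_partition_type:
  assumes "finite A" "partition_on A S"
  shows "sorted_wrt (\<ge>) (partition_type S)"
  using blocks(2)[OF assms]
  by (auto simp: partition_type_def sorted_wrt_map block_before_def elim!: sorted_wrt_mono_rel[rotated])

lemma sorted_wrt_ge_eqI:
  fixes xs ys :: "'a::linorder list"
  assumes "mset xs = mset ys" "sorted_wrt (\<ge>) xs" "sorted_wrt (\<ge>) ys"
  shows "xs = ys"
proof -
  have "rev xs = rev ys"
    using assms by (metis mset_rev properties_for_sort rev_rev_ident sorted_wrt_rev)
  then show ?thesis by simp
qed

lemma ex_block: "partition_on A S \<Longrightarrow> x \<in> A \<Longrightarrow> \<exists>s\<in>S. x \<in> s"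
  unfolding partition_on_def by blast

lemma block_subset: "partition_on A S \<Longrightarrow> s \<in> S \<Longrightarrow> s \<subseteq> A"
  unfolding partition_on_def by blast

lemma block_of_eq:
  assumes "partition_on A S" "s \<in> S" "x \<in> s"
  shows "block_of S x = s"
  unfolding block_of_def
  using assms by (intro the_equality) (auto simp: partition_on_def disjoint_def)

text \<open>Blocks are disjoint and listed without repetition, so \<open>x\<close> fixes the
  position; \<open>Suc\<close> converts it to an index counted from 1.\<close>

lemma block_index_eq:
  assumes "finite A" "partition_on A S" "r < length (blocks S)" "x \<in> blocks S ! r"
  shows "block_index S x = Suc r"
  unfolding block_index_def
proof (rule the_equality)
  fix k
  assume k: "1 \<le> k \<and> k \<le> length (blocks S) \<and> x \<in> blocks S ! (k - 1)"
  then have "k - 1 < length (blocks S)" by linarith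
  then have mem: "blocks S ! (k - 1) \<in> S" "blocks S ! r \<in> S"
    using assms(3) blocks(1)[OF assms(1,2)] nth_mem by blast+
  have "blocks S ! (k - 1) = blocks S ! r"
    using block_of_eq[OF assms(2) mem(1)] block_of_eq[OF assms(2) mem(2)] k assms(4) by metis
  then have "k - 1 = r"
    using distinct_blocks[OF assms(1,2)] assms(3) \<open>k - 1 < length (blocks S)\<close>
    by (simp add: nth_eq_iff_index_eq)
  then show "k = Suc r" using k by linarith
qed (use assms in auto)

lemma restrict_partition_restrict_partition:
  assumes "i \<le> n"
  shows "restrict_partition (restrict_partition S n) i = restrict_partition S i"
proof -
  let ?f = "\<lambda>i s. s \<inter> {1..i :: nat}"
  have "?f i \<circ> ?f n = ?f i" using assms by (auto simp: fun_eq_iff)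
  then have "?f i ` ?f n ` S = ?f i ` S" by (metis image_comp)
  moreover have "?f i ` (?f n ` S - {{}}) - {{}} = ?f i ` ?f n ` S - {{}}" by auto
  ultimately show ?thesis by (simp add: restrict_partition_def)
qed

lemma partition_on_restrict_partition:
  assumes "partition_on {1..m} S" "n \<le> m"
  shows "partition_on {1..n} (restrict_partition S n)"
proof (rule partition_onI)
  have "\<Union> (restrict_partition S n) = \<Union>S \<inter> {1..n}"
    unfolding restrict_partition_def by blast
  also have "\<Union>S = {1..m}" using partition_onD1[OF assms(1)] by simp
  finally show "\<Union> (restrict_partition S n) = {1..n}" using assms(2) by auto
  show "disjnt p q" if "p \<in> restrict_partition S n" "q \<in> restrict_partition S n" "p \<noteq> q" for p q
  proof -
    obtain s t where "s \<in> S" "t \<in> S" "p = s \<inter> {1..n}" "q = t \<inter> {1..n}"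
      using \<open>p \<in> _\<close> \<open>q \<in> _\<close> unfolding restrict_partition_def by blast
    moreover from this have "s \<inter> t = {}"
      using partition_onD2[OF assms(1)] \<open>p \<noteq> q\<close> by (metis disjointD)
    ultimately show ?thesis by (auto simp: disjnt_def)
  qed
qed (simp add: restrict_partition_def)

lemma restrict_partition_self:
  assumes "partition_on {1..n} S"
  shows "restrict_partition S n = S"
proof -
  have "s \<inter> {1..n} = s" if "s \<in> S" for s
    using block_subset[OF assms that] by blast
  then show ?thesis using partition_onD3[OF assms] by (auto simp: restrict_partition_def)
qed

text \<open>The factor of \<open>i\<close> involves only restrictions to \<open>i\<close> and
  \<open>i - 1\<close> and the least element of the block of \<open>i\<close>. That element is at
  most \<open>i\<close>, so it survives the restriction to [n].\<close>

lemma step_weight_restrict_partition: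
  assumes "partition_on {1..m} S" "n \<le> m" "i \<in> {1..n}"
  shows "step_weight (restrict_partition S n) q i = step_weight S q i"
proof -
  have "i \<in> {1..m}" using assms(2,3) by simp
  then obtain s where s: "s \<in> S" "i \<in> s" using ex_block[OF assms(1)] by blast
  have t: "s \<inter> {1..n} \<in> restrict_partition S n" "i \<in> s \<inter> {1..n}"
    using s assms(3) unfolding restrict_partition_def by blast+
  have sub: "s \<subseteq> {1..m}" by (rule block_subset[OF assms(1) s(1)])
  then have fin: "finite s" by (rule finite_subset) simp
  have "Min s \<in> s" using fin s(2) by (intro Min_in) auto
  moreover have "Min s \<le> i" using fin s(2) by simp
  moreover from calculation have "1 \<le> Min s" using sub by auto
  ultimately have "Min s \<in> s \<inter> {1..n}" using assms(3) by simp
  then have "Min (s \<inter> {1..n}) = Min s" using fin by (intro Min_eqI) simp_all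
  then have "Min (block_of (restrict_partition S n) i) = Min (block_of S i)"
    using block_of_eq[OF assms(1) s] block_of_eq[OF partition_on_restrict_partition[OF assms(1,2)] t]
    by simp
  moreover have "i \<le> n" "i - 1 \<le> n" using assms(3) by auto
  ultimately show ?thesis
    by (simp add: step_weight_def restrict_partition_restrict_partition)
qed

text \<open>Positions count from 0, and \<open>length (blocks S)\<close> stands for a new singleton
  block, in parallel with the first empty row in \<open>add_box\<close>.\<close>

definition extend_partition :: "nat \<Rightarrow> nat set set \<Rightarrow> nat \<Rightarrow> nat set set" where
  "extend_partition n S r =
    (if r < length (blocks S)
     then insert (insert (Suc n) (blocks S ! r)) (S - {blocks S ! r})
     else insert {Suc n} S)"

context
  fixes n :: nat and S :: "nat set set"
  assumes S: "partition_on {1..n} S"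
begin

lemma not_mem_block: "s \<in> S \<Longrightarrow> Suc n \<notin> s"
  using block_subset[OF S] by fastforce

lemma nth_blocks_mem: "r < length (blocks S) \<Longrightarrow> blocks S ! r \<in> S"
  using blocks(1)[OF _ S] nth_mem by blast

lemma partition_on_extend_partition: "partition_on {1..Suc n} (extend_partition n S r)"
proof -
  have un: "\<Union>S = {1..n}" using partition_onD1[OF S] by simp
  show ?thesis
  proof (cases "r < length (blocks S)")
    case True
    let ?B = "blocks S ! r"
    have B: "?B \<in> S" using True by (rule nth_blocks_mem)
    have E: "extend_partition n S r = insert (insert (Suc n) ?B) (S - {?B})"
      using True by (simp add: extend_partition_def)
    show ?thesis unfolding E
    proof (rule partition_onI)
      have "\<Union> (insert (insert (Suc n) ?B) (S - {?B})) = insert (Suc n) (\<Union>S)" using B by blast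
      then show "\<Union> (insert (insert (Suc n) ?B) (S - {?B})) = {1..Suc n}" using un by auto
      show "disjnt p q"
        if "p \<in> insert (insert (Suc n) ?B) (S - {?B})" "q \<in> insert (insert (Suc n) ?B) (S - {?B})"
          "p \<noteq> q" for p q
      proof -
        have disj: "s \<inter> t = {}" if "s \<in> S" "t \<in> S" "s \<noteq> t" for s t
          using disjointD[OF partition_onD2[OF S]] that by blast
        show ?thesis
          using that B not_mem_block disj[of ?B q] disj[of p ?B] disj[of p q]
          by (auto simp: disjnt_def)
      qed
    qed (use partition_onD3[OF S] in simp)
  next
    case False
    have E: "extend_partition n S r = insert {Suc n} S"
      using False by (simp add: extend_partition_def)
    show ?thesis unfolding E
    proof (rule partition_onI)
      show "\<Union> (insert {Suc n} S) = {1..Suc n}" using un by auto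
      show "disjnt p q" if "p \<in> insert {Suc n} S" "q \<in> insert {Suc n} S" "p \<noteq> q" for p q
      proof -
        have "p \<inter> q = {}" if "p \<in> S" "q \<in> S"
          using disjointD[OF partition_onD2[OF S]] that \<open>p \<noteq> q\<close> by blast
        then show ?thesis
          using that not_mem_block by (auto simp: disjnt_def)
      qed
    qed (use partition_onD3[OF S] in simp)
  qed
qed

lemma restrict_partition_extend_partition: "restrict_partition (extend_partition n S r) n = S"
proof -
  have int: "s \<inter> {1..n} = s" if "s \<in> S" for s using block_subset[OF S that] by blast
  have im: "(\<lambda>s. s \<inter> {1..n}) ` T = T" if "T \<subseteq> S" for T
    using image_cong[of T T "\<lambda>s. s \<inter> {1..n}" "\<lambda>s. s"] int that by (simp add: subset_iff)
  show ?thesis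
  proof (cases "r < length (blocks S)")
    case True
    let ?B = "blocks S ! r"
    have B: "?B \<in> S" using True by (rule nth_blocks_mem)
    have "restrict_partition (extend_partition n S r) n = insert ?B (S - {?B}) - {{}}"
      using True int[OF B] im[of "S - {?B}"]
      by (simp add: restrict_partition_def extend_partition_def Int_insert_left)
    then show ?thesis using B partition_onD3[OF S] by auto
  next
    case False
    then have "restrict_partition (extend_partition n S r) n = insert {} S - {{}}"
      using im[of S] by (simp add: restrict_partition_def extend_partition_def)
    then show ?thesis using partition_onD3[OF S] by auto
  qed
qed

text \<open>An enlarged block may change its place in the standard listing. Therefore multisets are
  compared, and both sides are sorted.\<close>

lemma partition_type_extend_partition:
  "partition_type (extend_partition n S r) = add_box (partition_type S) r"
proof (rule sorted_wrt_ge_eqI)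
  have fin: "finite S" using finite_elements[OF _ S] by simp
  have ext: "mset (partition_type (extend_partition n S r)) =
      image_mset card (mset_set (extend_partition n S r))"
    by (rule mset_partition_type[OF _ partition_on_extend_partition]) simp
  have len: "length (partition_type S) = length (blocks S)" by (simp add: partition_type_def)
  show "mset (partition_type (extend_partition n S r)) = mset (add_box (partition_type S) r)"
  proof (cases "r < length (blocks S)")
    case True
    let ?B = "blocks S ! r"
    have B: "?B \<in> S" using True by (rule nth_blocks_mem)
    have finB: "finite ?B" by (rule finite_subset[OF block_subset[OF S B]]) simp
    \<comment> \<open>The enlarged block differs from all others, so it adds a separate element to
      the multiset.\<close>
    have "insert (Suc n) ?B \<notin> S - {?B}" using not_mem_block by auto
    then have "mset (partition_type (extend_partition n S r)) =
        add_mset (Suc (card ?B)) (image_mset card (mset_set (S - {?B})))"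
      using True fin finB not_mem_block[OF B] by (simp add: ext) (simp add: extend_partition_def)
    moreover have "image_mset card (mset_set (S - {?B})) =
        mset (partition_type S) - {#card ?B#}"
      using fin B by (simp add: mset_partition_type[OF _ S] mset_set_Diff image_mset_Diff)
    ultimately show ?thesis
      using True by (simp add: mset_add_box len mset_update partition_type_def)
  next
    case False
    have "{Suc n} \<notin> S" using not_mem_block by auto
    then show ?thesis
      using False fin mset_partition_type[OF _ S]
      by (simp add: ext mset_add_box len) (simp add: extend_partition_def)
  qed
qed (simp_all add: sorted_partition_type[OF _ partition_on_extend_partition] add_box_def
    sorted_wrt_ge_rev_sort)

text \<open>n + 1 is the least element of its block only if the block is new. Otherwise the least
  element is that of the old block, which locates this block in \<open>S\<close>.\<close>

lemma step_weight_extend_partition: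
  "step_weight (extend_partition n S r) q (Suc n) = box_weight n (length (partition_type S)) q r"
proof (cases "r < length (blocks S)")
  case True
  let ?B = "blocks S ! r" and ?E = "extend_partition n S r"
  have B: "?B \<in> S" using True by (rule nth_blocks_mem)
  have sub: "?B \<subseteq> {1..n}" by (rule block_subset[OF S B])
  then have finB: "finite ?B" by (rule finite_subset) simp
  have ne: "?B \<noteq> {}" using partition_onD3[OF S] B by auto
  have MinB: "Min ?B \<in> ?B" using finB ne by (rule Min_in)
  have "insert (Suc n) ?B \<in> ?E" using True by (simp add: extend_partition_def)
  then have "block_of ?E (Suc n) = insert (Suc n) ?B"
    by (rule block_of_eq[OF partition_on_extend_partition]) simp
  moreover have "Min (insert (Suc n) ?B) = Min ?B"
    using finB ne MinB sub by (simp add: min_def) force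
  ultimately have Min: "Min (block_of ?E (Suc n)) = Min ?B" by simp
  have "Min ?B \<noteq> Suc n" using MinB sub by auto
  \<comment> \<open>The index counts from 1 and \<open>r\<close> from 0, whence the exponent
    \<open>n - Suc r\<close> in \<open>box_weight\<close>.\<close>
  moreover have "block_index S (Min ?B) = Suc r"
    by (rule block_index_eq[OF _ S True MinB]) simp
  ultimately show ?thesis
    using True Min restrict_partition_self[OF partition_on_extend_partition[of r]]
    by (simp add: step_weight_def box_weight_def restrict_partition_extend_partition
        partition_type_def)
next
  case False
  then have "{Suc n} \<in> extend_partition n S r" by (simp add: extend_partition_def)
  then have "block_of (extend_partition n S r) (Suc n) = {Suc n}"
    by (rule block_of_eq[OF partition_on_extend_partition]) simp
  then show ?thesis
    using False by (simp add: step_weight_def box_weight_def restrict_partition_extend_partition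
        partition_type_def)
qed

text \<open>The factors up to \<open>n\<close> depend only on the restriction to [n], which is
  \<open>S\<close>.\<close>

lemma weight_extend_partition:
  "weight (Suc n) (extend_partition n S r) q =
    weight n S q * box_weight n (length (partition_type S)) q r"
proof -
  have "step_weight (extend_partition n S r) q i = step_weight S q i" if "i \<in> {1..n}" for i
    using step_weight_restrict_partition[OF partition_on_extend_partition _ that]
    by (metis le_SucI order_refl restrict_partition_extend_partition)
  then show ?thesis
    by (simp add: weight_def step_weight_extend_partition mult.commute
        del: atLeastAtMost_iff cong: prod.cong)
qed

text \<open>The block of n + 1 without n + 1 is \<open>blocks S ! r\<close>, or empty for a new
  block. Blocks are nonempty and distinct, so this set determines \<open>r\<close>.\<close>

lemma inj_on_extend_partition: "inj_on (extend_partition n S) {..length (blocks S)}"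
proof (rule inj_onI)
  fix r r'
  assume r: "r \<in> {..length (blocks S)}" "r' \<in> {..length (blocks S)}"
    and eq: "extend_partition n S r = extend_partition n S r'"
  let ?b = "\<lambda>r. if r < length (blocks S) then blocks S ! r else {}"
  have "insert (Suc n) (?b r) \<in> extend_partition n S r" for r
    by (simp add: extend_partition_def)
  then have "block_of (extend_partition n S r) (Suc n) = insert (Suc n) (?b r)" for r
    by (rule block_of_eq[OF partition_on_extend_partition]) simp
  then have "insert (Suc n) (?b r) = insert (Suc n) (?b r')" using eq by metis
  moreover have nb: "Suc n \<notin> ?b r" for r using not_mem_block[OF nth_blocks_mem] by simp
  ultimately have "?b r = ?b r'" using insert_ident[OF nb[of r] nb[of r']] by simp
  moreover have "blocks S ! r \<noteq> {}" if "r < length (blocks S)" for r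
    using nth_blocks_mem[OF that] partition_onD3[OF S] by auto
  ultimately show "r = r'"
    using r distinct_blocks[OF _ S] by (auto simp: nth_eq_iff_index_eq split: if_splits)
qed

end

text \<open>Take n + 1 out of its block s. If nothing remains, a new block was formed; otherwise the
  rest is a block of the restriction, and its position is the required \<open>r\<close>.\<close>

lemma ex_extend_partition:
  assumes "partition_on {1..Suc n} S"
  shows "\<exists>r\<le>length (blocks (restrict_partition S n)).
    S = extend_partition n (restrict_partition S n) r"
proof -
  let ?R = "restrict_partition S n"
  have R: "partition_on {1..n} ?R" by (rule partition_on_restrict_partition[OF assms]) simp
  have "Suc n \<in> {1..Suc n}" by simp
  then obtain s where s: "s \<in> S" "Suc n \<in> s" using ex_block[OF assms] by blast
  have cut: "s \<inter> {1..n} = s - {Suc n}"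
    using block_subset[OF assms s(1)] by (auto simp: atLeastAtMostSuc_conv)
  have other: "t \<inter> {1..n} = t \<and> t \<noteq> {}" if "t \<in> S - {s}" for t
  proof -
    have "s \<inter> t = {}" using disjointD[OF partition_onD2[OF assms] s(1)] that by blast
    then have "Suc n \<notin> t" using s(2) by blast
    moreover have tS: "t \<in> S" using that by simp
    ultimately have "t \<subseteq> {1..Suc n} - {Suc n}" using block_subset[OF assms tS] by blast
    also have "{1..Suc n} - {Suc n} = {1..n}" by auto
    finally have "t \<inter> {1..n} = t" by (rule Int_absorb2)
    moreover have "t \<noteq> {}" using partition_onD3[OF assms] tS by metis
    ultimately show ?thesis ..
  qed
  have "S = insert s (S - {s})" using s(1) by auto
  then have "?R = insert (s \<inter> {1..n}) ((\<lambda>t. t \<inter> {1..n}) ` (S - {s})) - {{}}"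
    unfolding restrict_partition_def by (metis image_insert)
  also have "(\<lambda>t. t \<inter> {1..n}) ` (S - {s}) = S - {s}"
    using image_cong[of "S - {s}" "S - {s}" "\<lambda>t. t \<inter> {1..n}" "\<lambda>t. t"] other by simp
  finally have R_eq: "?R = insert (s - {Suc n}) (S - {s}) - {{}}" by (simp only: cut)
  show ?thesis
  proof (cases "s = {Suc n}")
    case True
    moreover have "{} \<notin> S - {s}" using partition_onD3[OF assms] by simp
    ultimately have "?R = S - {s}" unfolding R_eq by simp
    \<comment> \<open>This position is out of range and selects the case of a new block.\<close>
    then have "S = extend_partition n ?R (length (blocks ?R))"
      using True s(1) by (auto simp: extend_partition_def)
    then show ?thesis by auto
  next
    case False
    have ne: "s - {Suc n} \<noteq> {}" using s(2) False by auto
    moreover have "{} \<notin> S - {s}" using partition_onD3[OF assms] by simp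
    ultimately have R_eq': "?R = insert (s - {Suc n}) (S - {s})" unfolding R_eq by simp
    then obtain r where r: "r < length (blocks ?R)" "blocks ?R ! r = s - {Suc n}"
      using blocks(1)[OF _ R] by (metis finite_atLeastAtMost in_set_conv_nth insertI1)
    \<comment> \<open>Hence removing this block from \<open>?R\<close> leaves all other blocks of
      \<open>S\<close> in place.\<close>
    have "s - {Suc n} \<notin> S - {s}"
    proof
      assume "s - {Suc n} \<in> S - {s}"
      then have "s \<inter> (s - {Suc n}) = {}"
        using disjointD[OF partition_onD2[OF assms] s(1)] by blast
      then show False using ne by blast
    qed
    then have "?R - {s - {Suc n}} = S - {s}" unfolding R_eq' by auto
    then have "S = extend_partition n ?R r"
      using r s by (simp add: extend_partition_def insert_absorb)
    then show ?thesis using r(1) by (intro exI[of _ r]) auto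
  qed
qed

text \<open>Restriction to [n] recovers \<open>S\<close> and the block of n + 1 recovers
  \<open>r\<close>, so the pairs parametrize the set partitions of [n + 1].\<close>

lemma sum_set_partitions_Suc:
  fixes f :: "nat set set \<Rightarrow> int"
  shows "(\<Sum>S | partition_on {1..Suc n} S. f S) =
    (\<Sum>S | partition_on {1..n} S. \<Sum>r\<le>length (blocks S). f (extend_partition n S r))"
proof -
  let ?P = "\<lambda>n. {S. partition_on {1..n :: nat} S}"
  have fin: "finite (?P n)" by (rule finitely_many_partition_on) simp
  have bij: "bij_betw (\<lambda>(S, r). extend_partition n S r)
      (Sigma (?P n) (\<lambda>S. {..length (blocks S)})) (?P (Suc n))"
    unfolding bij_betw_def
  proof (intro conjI inj_onI subset_antisym subsetI)
    fix x y
    assume x: "x \<in> Sigma (?P n) (\<lambda>S. {..length (blocks S)})"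
      and y: "y \<in> Sigma (?P n) (\<lambda>S. {..length (blocks S)})"
      and eq: "(case x of (S, r) \<Rightarrow> extend_partition n S r) = (case y of (S, r) \<Rightarrow> extend_partition n S r)"
    obtain S r S' r' where xy: "x = (S, r)" "y = (S', r')" by fastforce
    have "S = S'"
      using restrict_partition_extend_partition[of n S r] restrict_partition_extend_partition[of n S' r']
        x y eq xy by simp
    moreover have "r = r'"
      using inj_onD[OF inj_on_extend_partition[of n S], of r r'] x y eq xy \<open>S = S'\<close> by simp
    ultimately show "x = y" using xy by simp
  next
    fix S
    assume "S \<in> (\<lambda>(S, r). extend_partition n S r) ` Sigma (?P n) (\<lambda>S. {..length (blocks S)})"
    then show "S \<in> ?P (Suc n)" using partition_on_extend_partition by auto
  next
    fix S
    assume "S \<in> ?P (Suc n)"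
    then have S: "partition_on {1..Suc n} S" by simp
    obtain r where r: "r \<le> length (blocks (restrict_partition S n))"
        "S = extend_partition n (restrict_partition S n) r"
      using ex_extend_partition[OF S] by blast
    have "partition_on {1..n} (restrict_partition S n)"
      by (rule partition_on_restrict_partition[OF S]) simp
    then show "S \<in> (\<lambda>(S, r). extend_partition n S r) ` Sigma (?P n) (\<lambda>S. {..length (blocks S)})"
      using r by (intro image_eqI[where x = "(restrict_partition S n, r)"]) auto
  qed
  have "(\<Sum>S\<in>?P n. \<Sum>r\<le>length (blocks S). f (extend_partition n S r)) =
      (\<Sum>(S, r)\<in>Sigma (?P n) (\<lambda>S. {..length (blocks S)}). f (extend_partition n S r))"
    using fin by (simp add: sum.Sigma)
  also have "\<dots> = (\<Sum>S\<in>?P (Suc n). f S)"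
    using sum.reindex_bij_betw[OF bij, of f] by (simp only: case_prod_unfold)
  finally show ?thesis by (simp only:)
qed

section \<open>The recursion\<close>

text \<open>The function \<open>g\<close> must be arbitrary: the inductive step applies the
  hypothesis to \<open>?h\<close>, the weighted sum of \<open>g\<close> over all enlargements by a
  box.\<close>

lemma sum_jordan_type_eq_sum_partition_type:
  fixes g :: "nat list \<Rightarrow> int"
  shows "(\<Sum>X\<in>(strictly_upper n :: 'a::{field,finite} mat set). g (jordan_type X)) =
    (\<Sum>S | partition_on {1..n} S. weight n S (int CARD('a)) * g (partition_type S))"
proof (induction n arbitrary: g)
  case 0
  \<comment> \<open>Both sides have one term: the empty matrix, and the partition without blocks,
    whose weight is the empty product.\<close>
  have X: "(1\<^sub>m 0 :: 'a mat) \<in> strictly_upper 0" by (simp add: strictly_upper_def)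
  have "strictly_upper 0 = {1\<^sub>m 0 :: 'a mat}" by (auto simp: strictly_upper_def intro!: eq_matI)
  moreover have "jordan_type (1\<^sub>m 0 :: 'a mat) = []"
    using jordan_type(1)[OF X] length_le_if_is_partition by fastforce
  moreover have "{S. partition_on {1..0 :: nat} S} = {{}}" by (auto simp: partition_on_empty)
  moreover have "blocks {} = []"
    using blocks(1)[of "{}" "{}"] by (simp add: partition_on_empty)
  ultimately show ?case by (simp add: partition_type_def weight_def)
next
  case (Suc n)
  let ?q = "int CARD('a)"
  let ?h = "\<lambda>mu. \<Sum>r\<le>length mu. box_weight n (length mu) ?q r * g (add_box mu r)"
  have "(\<Sum>X\<in>(strictly_upper (Suc n) :: 'a mat set). g (jordan_type X)) =
      (\<Sum>(A, v)\<in>strictly_upper n \<times> (carrier_vec n :: 'a vec set). g (jordan_type (border A v)))"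
    using sum.reindex_bij_betw[OF bij_betw_border, of "\<lambda>X. g (jordan_type X)" n]
    unfolding case_prod_unfold by (rule sym)
  also have "\<dots> = (\<Sum>A\<in>strictly_upper n. \<Sum>v\<in>(carrier_vec n :: 'a vec set). g (jordan_type (border A v)))"
    by (rule sum.cartesian_product[symmetric])
  also have "\<dots> = (\<Sum>A\<in>(strictly_upper n :: 'a mat set). ?h (jordan_type A))"
    by (rule sum.cong[OF refl sum_jordan_type_border])
  also have "\<dots> = (\<Sum>S | partition_on {1..n} S. weight n S ?q * ?h (partition_type S))"
    by (rule Suc.IH)
  also have "\<dots> = (\<Sum>S | partition_on {1..n} S. \<Sum>r\<le>length (blocks S).
      weight (Suc n) (extend_partition n S r) ?q * g (partition_type (extend_partition n S r)))"
  proof (rule sum.cong[OF refl])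
    fix S
    assume "S \<in> {S. partition_on {1..n} S}"
    then have S: "partition_on {1..n} S" by simp
    have len: "length (partition_type S) = length (blocks S)" by (simp add: partition_type_def)
    show "weight n S ?q * ?h (partition_type S) = (\<Sum>r\<le>length (blocks S).
        weight (Suc n) (extend_partition n S r) ?q * g (partition_type (extend_partition n S r)))"
      unfolding sum_distrib_left weight_extend_partition[OF S] partition_type_extend_partition[OF S] len
      by (simp only: mult.assoc)
  qed
  also have "\<dots> = (\<Sum>S | partition_on {1..Suc n} S. weight (Suc n) S ?q * g (partition_type S))"
    by (rule sum_set_partitions_Suc[symmetric])
  finally show ?case .
qed

theorem corollary4p4:
  fixes n :: nat and lam :: "nat list"
  assumes "n \<ge> 1" and "is_partition n lam"
  shows "int (card (upper_nilpotents_of_type n lam :: 'a::{field,finite} mat set)) =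
    (\<Sum>S\<in>set_partitions_of_type n lam. weight n S (int CARD('a)))"
proof -
  \<comment> \<open>The indicator function of \<open>lam\<close> turns one side into a count and the
    other into the sum over set partitions of type \<open>lam\<close>.\<close>
  let ?g = "\<lambda>mu. if mu = lam then 1 else 0 :: int"
  have fin: "finite {S. partition_on {1..n :: nat} S}" by (rule finitely_many_partition_on) simp
  have "int (card (upper_nilpotents_of_type n lam :: 'a mat set)) =
      (\<Sum>X\<in>(strictly_upper n :: 'a mat set). ?g (jordan_type X))"
    unfolding upper_nilpotents_of_type_eq[OF assms(2)]
    by (simp add: finite_strictly_upper flip: sum.inter_filter)
  also have "\<dots> = (\<Sum>S | partition_on {1..n} S. weight n S (int CARD('a)) * ?g (partition_type S))"
    by (rule sum_jordan_type_eq_sum_partition_type)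
  also have "\<dots> = (\<Sum>S | partition_on {1..n} S.
      if partition_type S = lam then weight n S (int CARD('a)) else 0)"
    by (rule sum.cong[OF refl]) simp
  also have "\<dots> = (\<Sum>S\<in>set_partitions_of_type n lam. weight n S (int CARD('a)))"
    using fin by (simp add: set_partitions_of_type_def flip: sum.inter_filter)
  finally show ?thesis .
qed

end
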